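(* Let $M\in\mathbb{R}^{n\times n}$ be a $P$-matrix, $b\in\mathbb{R}^n$, $A=[M\ \ -I_n]$, and $Q\in\{(AA^{\top})^{-1},I_n\}$. Consider the three algorithms $w^{k+1}\in T(w^k)$ with $T=T^\lambda_{\rm PDMC}$, $\lambda\in(0,1/L_Q]$; $T=T^\lambda_{\rm FB}$, $\lambda\in(0,1/L_Q)$; and $T=T^\lambda_{\rm PS}$, $\lambda\in(0,1/L_Q)$. These algorithms and their accelerated versions (described in the context) are globally convergent to $S_1\cap S_2$, i.e. from any starting point $w^0\in\mathbb{R}^{2n}$, any sequence they generate converges to the unique point of $S_1\cap S_2$. Moreover, the (non-accelerated) projected subgradient algorithm $w^{k+1}\in T^\lambda_{\rm PS}(w^k)$ converges $Q$-linearly to $S_1\cap S_2$.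
   Context: A square matrix is a $P$-matrix if all of its principal minors are positive; it is known that then $S_1\cap S_2$ below is a singleton for every $b$. Here $$S_1=\{w\in\mathbb{R}^{2n}:Aw=b\},\quad S_2=\{w\in\mathbb{R}^{2n}: w_j\ge0,\ w_{n+j}\ge0,\ w_jw_{n+j}=0\ \ \forall j\in\{1,\dots,n\}\},$$ which is the feasibility reformulation of the linear complementarity problem $x\ge0$, $Mx-b\ge0$, $\langle x,Mx-b\rangle=0$ with $w=(x,Mx-b)$. $\|\cdot\|$ is the Euclidean norm (operator norm for matrices); $P_S(w)=\arg\min_{z\in S}\|w-z\|$ (possibly set-valued); $\delta_S$ is the indicator function of $S$ ($0$ on $S$, $+\infty$ off $S$). $f_Q(w)=\frac12w^{\top}A^{\top}QAw-w^{\top}A^{\top}Qb+\frac12b^{\top}Qb$, with $\nabla f_Q(w)=A^{\top}Q(Aw-b)$; $L_Q=1$ if $Q=(AA^{\top})^{-1}$ and $L_Q=\|A\|^2$ if $Q=I_n$. Operators: $$T^\lambda_{\rm PDMC}(w)=\tfrac{1}{1+\lambda}\big(w-\lambda\nabla f_Q(w)+\lambda P_{S_2}(w)\big),$$ $$T^\lambda_{\rm FB}(w)=\tfrac{\lambda}{1+\lambda}P_{S_2}(w-\lambda\nabla f_Q(w))+\tfrac{1}{1+\lambda}(w-\lambda\nabla f_Q(w)),$$ $$T^\lambda_{\rm PS}(w)=P_{S_2}(w-\lambda\nabla f_Q(w)).$$ Decomposition of $S_2$: let $\mathcal{I}$ be the set of all $\iota\subset\{1,\dots,2n\}$ of the form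 $\iota=\Lambda_1\cup\{n+j: j\in\{1,\dots,n\}\setminus\Lambda_1\}$ with $\Lambda_1\subset\{1,\dots,n\}$, and $R_\iota=\{w\in\mathbb{R}^{2n}: w\ge0,\ w_i=0\ \forall i\notin\iota\}$. Then $S_2=\bigcup_{\iota\in\mathcal{I}}R_\iota$. Accelerated versions: let $V=f_Q+\frac12\mathrm{dist}(\cdot,S_2)^2$ for $T^\lambda_{\rm PDMC}$ and $T^\lambda_{\rm FB}$, and $V=f_Q+\delta_{S_2}$ for $T^\lambda_{\rm PS}$. Let $\hat D_\iota=\{w:\mathrm{dist}(w,S_2)=\mathrm{dist}(w,R_\iota)\}$ for PDMC and FB, and $\hat D_\iota=R_\iota$ for PS ($\iota\in\mathcal{I}$). With the same stepsize $\lambda$ as the corresponding non-accelerated algorithm, choose $\sigma>0$ and $w^0\in\mathbb{R}^{2n}$, set $w^{-1}=w^0$, and for $k=0,1,\dots$: let $\chi_k=1$ if $k\ge1$ and $w^k,w^{k-1}$ belong to a common $\hat D_\iota$, and $\chi_k=0$ otherwise; set $p^k=\chi_k(w^k-w^{k-1})$, $z^k=w^k+t_kp^k$ with $t_k\ge0$ satisfying $V(z^k)\le V(w^k)-\frac{\sigma}{2}t_k^2\|p^k\|^2$; select $w^{k+1}\in T(z^k)$. $Q$-linear convergence to $w^*$ means there is $\kappa\in[0,1)$ with $\|w^{k+1}-w^*\|\le\kappa\|w^k-w^*\|$ for all sufficiently large $k$. *)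

theory Defs
  imports "HOL-Analysis.Analysis"
begin

text \<open>
  The space \<open>\<real>\<^sup>2\<^sup>n\<close> is \<^typ>\<open>real^('n + 'n)\<close>: the coordinate \<open>j\<close> is \<open>Inl j\<close> and the
  coordinate \<open>n + j\<close> is \<open>Inr j\<close>.
\<close>

text \<open>The Leibniz formula for the determinant of the submatrix of \<open>M\<close> with rows and columns
  in \<open>I\<close> (the library determinant needs the index set to be a type).\<close>

definition principal_minor :: "real^'n^'n \<Rightarrow> 'n set \<Rightarrow> real" where
  "principal_minor M I = (\<Sum>p | p permutes I. of_int (sign p) * (\<Prod>i\<in>I. M $ i $ p i))"

lemma principal_minor_UNIV: "principal_minor M UNIV = det M"
  by (simp add: principal_minor_def det_def)

definition P_matrix :: "real^'n^'n \<Rightarrow> bool" where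
  "P_matrix M \<longleftrightarrow> (\<forall>I. I \<noteq> {} \<longrightarrow> 0 < principal_minor M I)"

text \<open>The block matrix \<open>[M  -I]\<close>.\<close>

definition lcp_matrix :: "real^'n^'n \<Rightarrow> real^('n + 'n)^'n" where
  "lcp_matrix M = (\<chi> i j. case j of Inl l \<Rightarrow> M $ i $ l | Inr l \<Rightarrow> - (mat 1 :: real^'n^'n) $ i $ l)"

definition S1 :: "real^('n + 'n)^'n \<Rightarrow> real^'n \<Rightarrow> (real^('n + 'n)) set" where
  "S1 A b = {w. A *v w = b}"

definition S2 :: "(real^('n::finite + 'n)) set" where
  "S2 = {w. \<forall>j. 0 \<le> w $ Inl j \<and> 0 \<le> w $ Inr j \<and> w $ Inl j * w $ Inr j = 0}"

definition proj_set :: "'a::real_normed_vector set \<Rightarrow> 'a \<Rightarrow> 'a set" where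
  "proj_set S w = {z. is_arg_min (\<lambda>z. norm (w - z)) (\<lambda>z. z \<in> S) z}"

definition indicator_fun :: "'a set \<Rightarrow> 'a \<Rightarrow> ereal" where
  "indicator_fun S w = (if w \<in> S then 0 else \<infinity>)"

definition f_Q :: "real^('n + 'n)^'n \<Rightarrow> real^'n \<Rightarrow> real^'n^'n \<Rightarrow> real^('n + 'n) \<Rightarrow> real" where
  "f_Q A b Q w = 1/2 * (w \<bullet> ((transpose A ** Q ** A) *v w))
     - w \<bullet> ((transpose A ** Q) *v b) + 1/2 * (b \<bullet> (Q *v b))"

definition grad_f_Q ::
  "real^('n + 'n)^'n \<Rightarrow> real^'n \<Rightarrow> real^'n^'n \<Rightarrow> real^('n + 'n) \<Rightarrow> real^('n + 'n)" where
  "grad_f_Q A b Q w = transpose A *v (Q *v (A *v w - b))"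

lemma f_Q_has_derivative:
  assumes "transpose Q = Q"
  shows "(f_Q A b Q has_derivative (\<lambda>h. grad_f_Q A b Q w \<bullet> h)) (at w)"
proof -
  let ?H = "transpose A ** Q ** A"
  have H: "?H *v h = transpose A *v (Q *v (A *v h))" for h
    by (simp only: matrix_vector_mul_assoc matrix_mul_assoc)
  have adj: "x \<bullet> (transpose B *v y) = (B *v x) \<bullet> y" for x y and B :: "real^'k^'l"
    by (simp only: transpose_matrix_vector inner_commute[of x] dot_lmul_matrix)
       (rule inner_commute)
  have adjQ: "x \<bullet> (Q *v y) = (Q *v x) \<bullet> y" for x y
    using adj[of x Q y] by (simp only: assms)
  have sym: "w \<bullet> (?H *v h) = (?H *v w) \<bullet> h" for h
  proof -
    have "w \<bullet> (?H *v h) = (Q *v (A *v w)) \<bullet> (A *v h)"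
      by (simp only: H adj adjQ)
    also have "\<dots> = h \<bullet> (?H *v w)"
      unfolding H adj by (rule inner_commute)
    finally show ?thesis
      by (simp only: inner_commute)
  qed
  have D: "((*v) ?H has_derivative (*v) ?H) (at w)"
    by (intro bounded_linear_imp_has_derivative matrix_vector_mul_bounded_linear)
  have "((\<lambda>w. 1/2 * (w \<bullet> (?H *v w)) - w \<bullet> ((transpose A ** Q) *v b) + 1/2 * (b \<bullet> (Q *v b)))
     has_derivative (\<lambda>h. 1/2 * (w \<bullet> (?H *v h) + h \<bullet> (?H *v w)) - h \<bullet> ((transpose A ** Q) *v b) + 0)) (at w)"
    by (intro has_derivative_add has_derivative_diff has_derivative_mult_right has_derivative_inner
        has_derivative_inner_left has_derivative_ident has_derivative_const D)
  moreover have "1/2 * (w \<bullet> (?H *v h) + h \<bullet> (?H *v w)) - h \<bullet> ((transpose A ** Q) *v b) + 0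
     = grad_f_Q A b Q w \<bullet> h" for h
  proof -
    have "grad_f_Q A b Q w = ?H *v w - (transpose A ** Q) *v b"
      by (simp only: grad_f_Q_def matrix_vector_mult_diff_distrib matrix_vector_mul_assoc
          matrix_mul_assoc)
    then have "grad_f_Q A b Q w \<bullet> h = (?H *v w) \<bullet> h - ((transpose A ** Q) *v b) \<bullet> h"
      by (simp only: inner_diff_left)
    moreover have "1/2 * (x + x) - y + 0 = x - y" for x y :: real
      by simp
    ultimately show ?thesis
      by (simp only: sym inner_commute[of h "?H *v w"] inner_commute[of h "(transpose A ** Q) *v b"])
  qed
  ultimately show ?thesis
    unfolding f_Q_def by (simp only:)
qed

text \<open>Only meant for \<open>Q = (A A\<^sup>T)\<^sup>-\<^sup>1\<close> and \<open>Q = I\<close>; the operator norm of \<open>A\<close> is taken with respect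
  to the Euclidean norms.\<close>

definition L_Q :: "real^('n + 'n)^'n \<Rightarrow> real^'n^'n \<Rightarrow> real" where
  "L_Q A Q = (if Q = matrix_inv (A ** transpose A) then 1 else (onorm ((*v) A))\<^sup>2)"

definition T_PDMC ::
  "real^('n + 'n)^'n \<Rightarrow> real^'n \<Rightarrow> real^'n^'n \<Rightarrow> real \<Rightarrow> real^('n + 'n) \<Rightarrow> (real^('n + 'n)) set" where
  "T_PDMC A b Q lam w =
     {(1 / (1 + lam)) *\<^sub>R (w - lam *\<^sub>R grad_f_Q A b Q w + lam *\<^sub>R p) | p. p \<in> proj_set S2 w}"

definition T_FB ::
  "real^('n + 'n)^'n \<Rightarrow> real^'n \<Rightarrow> real^'n^'n \<Rightarrow> real \<Rightarrow> real^('n + 'n) \<Rightarrow> (real^('n + 'n)) set" where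
  "T_FB A b Q lam w =
     {(lam / (1 + lam)) *\<^sub>R p + (1 / (1 + lam)) *\<^sub>R (w - lam *\<^sub>R grad_f_Q A b Q w) | p.
        p \<in> proj_set S2 (w - lam *\<^sub>R grad_f_Q A b Q w)}"

definition T_PS ::
  "real^('n + 'n)^'n \<Rightarrow> real^'n \<Rightarrow> real^'n^'n \<Rightarrow> real \<Rightarrow> real^('n + 'n) \<Rightarrow> (real^('n + 'n)) set" where
  "T_PS A b Q lam w = proj_set S2 (w - lam *\<^sub>R grad_f_Q A b Q w)"

definition compl_index_sets :: "('n + 'n) set set" where
  "compl_index_sets = {Inl ` K \<union> Inr ` (UNIV - K) | K. True}"

definition R_piece :: "('n::finite + 'n) set \<Rightarrow> (real^('n + 'n)) set" where
  "R_piece J = {w. (\<forall>i. 0 \<le> w $ i) \<and> (\<forall>i. i \<notin> J \<longrightarrow> w $ i = 0)}"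

lemma S2_eq_Union: "(S2 :: (real^('n::finite + 'n)) set) = (\<Union>J\<in>compl_index_sets. R_piece J)"
proof (intro equalityI subsetI)
  fix w :: "real^('n + 'n)"
  assume w: "w \<in> S2"
  let ?J = "Inl ` {j. w $ Inr j = 0} \<union> Inr ` (UNIV - {j. w $ Inr j = 0})"
  have "0 \<le> w $ i" for i
    using w by (cases i) (simp_all add: S2_def)
  moreover have "w $ i = 0" if "i \<notin> ?J" for i
  proof (cases i)
    case (Inl j)
    with that have "w $ Inr j \<noteq> 0" by blast
    moreover have "w $ Inl j * w $ Inr j = 0" using w by (simp add: S2_def)
    ultimately show ?thesis using Inl by simp
  next
    case (Inr j)
    with that show ?thesis by blast
  qed
  ultimately have "w \<in> R_piece ?J"
    unfolding R_piece_def by blast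
  then show "w \<in> (\<Union>J\<in>compl_index_sets. R_piece J)"
    unfolding compl_index_sets_def by blast
next
  fix w :: "real^('n + 'n)"
  assume "w \<in> (\<Union>J\<in>compl_index_sets. R_piece J)"
  then obtain K where K: "w \<in> R_piece (Inl ` K \<union> Inr ` (UNIV - K))"
    unfolding compl_index_sets_def by blast
  have "w $ Inl j = 0 \<or> w $ Inr j = 0" for j
  proof (cases "j \<in> K")
    case True
    then have "Inr j \<notin> Inl ` K \<union> Inr ` (UNIV - K)" by blast
    with K show ?thesis unfolding R_piece_def by blast
  next
    case False
    then have "Inl j \<notin> Inl ` K \<union> Inr ` (UNIV - K)" by blast
    with K show ?thesis unfolding R_piece_def by blast
  qed
  with K show "w \<in> S2"
    by (simp add: S2_def R_piece_def)
qed

definition D_dist :: "('n::finite + 'n) set \<Rightarrow> (real^('n + 'n)) set" where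
  "D_dist J = {w. infdist w S2 = infdist w (R_piece J)}"

text \<open>Merit functions: \<open>V_dist\<close> for \<open>T_PDMC\<close> and \<open>T_FB\<close> (with the sets \<open>D_dist\<close>), \<open>V_ind\<close> for
  \<open>T_PS\<close> (with the sets \<open>R_piece\<close>).\<close>

definition V_dist :: "real^('n + 'n)^'n \<Rightarrow> real^'n \<Rightarrow> real^'n^'n \<Rightarrow> real^('n + 'n) \<Rightarrow> ereal" where
  "V_dist A b Q w = ereal (f_Q A b Q w + 1/2 * (infdist w S2)\<^sup>2)"

definition V_ind :: "real^('n + 'n)^'n \<Rightarrow> real^'n \<Rightarrow> real^'n^'n \<Rightarrow> real^('n + 'n) \<Rightarrow> ereal" where
  "V_ind A b Q w = ereal (f_Q A b Q w) + indicator_fun S2 w"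

definition iterates :: "('a \<Rightarrow> 'a set) \<Rightarrow> (nat \<Rightarrow> 'a) \<Rightarrow> bool" where
  "iterates T w \<longleftrightarrow> (\<forall>k. w (Suc k) \<in> T (w k))"

definition chi ::
  "(('n::finite + 'n) set \<Rightarrow> (real^('n + 'n)) set) \<Rightarrow> (nat \<Rightarrow> real^('n + 'n)) \<Rightarrow> nat \<Rightarrow> real" where
  "chi D w k = (if 1 \<le> k \<and> (\<exists>J\<in>compl_index_sets. w k \<in> D J \<and> w (k - 1) \<in> D J) then 1 else 0)"

text \<open>The truncated subtraction \<open>0 - 1 = 0\<close> encodes the convention \<open>w\<^sup>-\<^sup>1 = w\<^sup>0\<close>.\<close>

definition direction ::
  "(('n::finite + 'n) set \<Rightarrow> (real^('n + 'n)) set) \<Rightarrow> (nat \<Rightarrow> real^('n + 'n)) \<Rightarrow> nat \<Rightarrow> real^('n + 'n)" where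
  "direction D w k = chi D w k *\<^sub>R (w k - w (k - 1))"

definition accelerated_iterates ::
  "(real^('n::finite + 'n) \<Rightarrow> (real^('n + 'n)) set) \<Rightarrow> (real^('n + 'n) \<Rightarrow> ereal) \<Rightarrow>
   (('n + 'n) set \<Rightarrow> (real^('n + 'n)) set) \<Rightarrow> real \<Rightarrow> (nat \<Rightarrow> real^('n + 'n)) \<Rightarrow> bool" where
  "accelerated_iterates T V D \<sigma> w \<longleftrightarrow>
     (\<exists>t :: nat \<Rightarrow> real. \<exists>z. \<forall>k. 0 \<le> t k \<and>
        z k = w k + t k *\<^sub>R direction D w k \<and>
        V (z k) \<le> V (w k) - ereal (\<sigma> / 2 * (t k)\<^sup>2 * (norm (direction D w k))\<^sup>2) \<and>
        w (Suc k) \<in> T (z k))"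

definition Q_linearly_converges :: "(nat \<Rightarrow> 'a::real_normed_vector) \<Rightarrow> 'a \<Rightarrow> bool" where
  "Q_linearly_converges w ws \<longleftrightarrow>
     (\<exists>\<kappa>. 0 \<le> \<kappa> \<and> \<kappa> < 1 \<and>
        (\<forall>\<^sub>F k in sequentially. norm (w (Suc k) - ws) \<le> \<kappa> * norm (w k - ws)))"

end

(*
  All three maps decrease the merit function f_Q + dist(., S2)^2 / 2 by a multiple of the squared
  step length, and extrapolation steps decrease it by assumption. This function is coercive, since
  a P-matrix makes A injective on the cone of all (x, y) with x_j y_j <= 0 for every j. Hence every
  cluster point of an algorithm is a fixed point of its map. A fixed point comes from some p in S2
  that is a projection of p - c grad f_Q, and grad f_Q = (M^T mu, -mu) with mu = Q (A w - b). The
  complementarity structure of S2 forces mu_j (M^T mu)_j <= 0 for every j, so mu = 0 because M^T is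
  a P-matrix, and the fixed point solves the problem.

  For the projected subgradient map, eventually the next iterate and the solution lie in a common
  convex piece of S2, so the projection is nonexpansive towards the solution, while the gradient
  step contracts differences of points of S2 by the same injectivity of A on the cone.
*)

theory Submission
  imports Defs
begin

section \<open>P-matrices\<close>

text \<open>In the Leibniz formula a permutation that moves an index outside \<open>K\<close> picks
  a zero entry of a unit row. This links \<open>principal_minor\<close> to the library determinant,
  so that linearity in the rows becomes available.\<close>

lemma det_rows_eq_principal_minor:
  fixes M :: "real^'n^'n"
  shows "det (\<chi> i. if i \<in> K then M $ i else axis i 1) = principal_minor M K"
proof -
  let ?N = "(\<chi> i. if i \<in> K then M $ i else axis i 1) :: real^'n^'n"
  have "det ?N = (\<Sum>p | p permutes K. of_int (sign p) * (\<Prod>i\<in>UNIV. ?N $ i $ p i))"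
    unfolding det_def
  proof (rule sum.mono_neutral_right)
    show "finite {p. p permutes (UNIV :: 'n set)}"
      by (simp add: finite_permutations)
    show "{p. p permutes K} \<subseteq> {p. p permutes UNIV}"
      using permutes_subset by blast
    show "\<forall>p\<in>{p. p permutes UNIV} - {p. p permutes K}.
        of_int (sign p) * (\<Prod>i\<in>UNIV. ?N $ i $ p i) = 0"
    proof
      fix p :: "'n \<Rightarrow> 'n"
      assume p: "p \<in> {p. p permutes UNIV} - {p. p permutes K}"
      then obtain i where i: "i \<notin> K" "p i \<noteq> i"
        unfolding permutes_def by blast
      then have "?N $ i $ p i = 0"
        by (auto simp: axis_def)
      then have "(\<Prod>i\<in>UNIV. ?N $ i $ p i) = 0"
        by (intro prod_zero) (auto simp del: vec_lambda_beta)
      then show "of_int (sign p) * (\<Prod>i\<in>UNIV. ?N $ i $ p i) = 0"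
        by simp
    qed
  qed
  also have "\<dots> = principal_minor M K"
    unfolding principal_minor_def
  proof (rule sum.cong[OF refl])
    fix p assume "p \<in> {p. p permutes K}"
    then have "p i = i" if "i \<notin> K" for i
      using that by (simp add: permutes_def)
    then have "(\<Prod>i\<in>UNIV. ?N $ i $ p i) = (\<Prod>i\<in>K. ?N $ i $ p i)"
      by (intro prod.mono_neutral_right) (auto simp: axis_def)
    also have "\<dots> = (\<Prod>i\<in>K. M $ i $ p i)"
      by (intro prod.cong) auto
    finally show "of_int (sign p) * (\<Prod>i\<in>UNIV. ?N $ i $ p i)
        = of_int (sign p) * (\<Prod>i\<in>K. M $ i $ p i)"
      by simp
  qed
  finally show ?thesis .
qed

lemma principal_minor_transpose: "principal_minor (transpose M) K = principal_minor M K"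
  unfolding principal_minor_def
proof (rule sum.reindex_bij_witness[where i = "inv" and j = "inv"])
  fix p assume p: "p \<in> {p. p permutes K}"
  have "finite K" by simp
  with p have sgn: "sign (inv p) = sign p"
    by (metis mem_Collect_eq permutation_permutes sign_inverse)
  have "(\<Prod>i\<in>K. M $ i $ inv p i) = (\<Prod>i\<in>K. M $ p i $ inv p (p i))"
    using p prod.permute[of p K "\<lambda>i. M $ i $ inv p i"] by (simp add: o_def)
  also have "\<dots> = (\<Prod>i\<in>K. transpose M $ i $ p i)"
    using p by (simp add: transpose_def permutes_inverses)
  finally show "of_int (sign (inv p)) * (\<Prod>i\<in>K. M $ i $ inv p i)
      = of_int (sign p) * (\<Prod>i\<in>K. transpose M $ i $ p i)"
    by (simp add: sgn)
qed (auto simp: permutes_inv_inv permutes_inv)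

lemma P_matrix_transpose: "P_matrix M \<Longrightarrow> P_matrix (transpose M)"
  by (simp add: P_matrix_def principal_minor_transpose)

text \<open>Induction on \<open>S\<close>: linearity in row \<open>s\<close> splits the determinant
  into one where \<open>s\<close> joins the unperturbed rows \<open>I\<close>, plus
  \<open>d s\<close> times one where row \<open>s\<close> is a unit vector. The set \<open>I\<close>
  exists to carry this induction; at empty \<open>S\<close> a principal minor remains (equal to 1 if
  \<open>I\<close> is empty).\<close>

lemma P_matrix_det_pos:
  fixes M :: "real^'n^'n"
  assumes M: "P_matrix M" and d: "\<And>i. 0 \<le> d i" and "I \<inter> S = {}"
  shows "0 < det (\<chi> i. if i \<in> S then M $ i + d i *s axis i 1
                    else if i \<in> I then M $ i else axis i 1)"
proof -
  have "finite S" by simp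
  then show ?thesis using \<open>I \<inter> S = {}\<close>
  proof (induction S arbitrary: I rule: finite_induct)
    case empty
    have "0 < principal_minor M I"
      using M by (cases "I = {}") (auto simp: P_matrix_def principal_minor_def)
    then show ?case
      by (simp add: det_rows_eq_principal_minor)
  next
    case (insert s S)
    let ?c = "\<lambda>i. if i \<in> S then M $ i + d i *s axis i 1 else if i \<in> I then M $ i else axis i 1"
    have "(\<chi> i. if i \<in> insert s S then M $ i + d i *s axis i 1
            else if i \<in> I then M $ i else axis i 1)
        = (\<chi> i. if i = s then M $ i + d i *s axis i 1 else ?c i)"
      by (auto simp: vec_eq_iff)
    then have "det (\<chi> i. if i \<in> insert s S then M $ i + d i *s axis i 1
            else if i \<in> I then M $ i else axis i 1)
        = det (\<chi> i. if i = s then M $ i else ?c i)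
          + det (\<chi> i. if i = s then d i *s axis i 1 else ?c i)"
      using det_row_add[of s "\<lambda>i. M $ i" "\<lambda>i. d i *s axis i 1" ?c] by simp
    also have "det (\<chi> i. if i = s then d i *s axis i 1 else ?c i)
        = d s * det (\<chi> i. if i = s then axis i 1 else ?c i)"
    proof -
      have "(\<chi> i. if i = s then d i *s axis i 1 else ?c i)
          = (\<chi> i. if i = s then d s *s axis i 1 else ?c i)"
        by (simp add: vec_eq_iff)
      then show ?thesis
        using det_row_mul[of s "d s" "\<lambda>i. axis i 1" ?c] by simp
    qed
    also have "(\<chi> i. if i = s then axis i 1 else ?c i) = (\<chi> i. ?c i)"
      using insert.hyps insert.prems by (auto simp: vec_eq_iff)
    also have "(\<chi> i. if i = s then M $ i else ?c i)
        = (\<chi> i. if i \<in> S then M $ i + d i *s axis i 1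
                else if i \<in> insert s I then M $ i else axis i 1)"
      using insert.hyps insert.prems by (auto simp: vec_eq_iff)
    finally show ?case
      using insert.IH[of "insert s I"] insert.IH[of I] insert.hyps insert.prems d[of s]
      by (simp add: add_pos_nonneg)
  qed
qed

text \<open>One direction of the Fiedler-Ptak characterization of P-matrices: a nonzero
  \<open>x\<close> of this kind would lie in the kernel of a matrix whose determinant is positive by
  \<open>P_matrix_det_pos\<close>.\<close>

lemma P_matrix_reverses_no_sign:
  fixes M :: "real^'n^'n"
  assumes M: "P_matrix M" and x: "\<And>j. x $ j * (M *v x) $ j \<le> 0"
  shows "x = 0"
proof (rule ccontr)
  assume "x \<noteq> 0"
  define S where "S = {j. x $ j \<noteq> 0}"
  \<comment> \<open>Chosen so that \<open>(M *v x) $ j + d j * x $ j = 0\<close> on the support of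
    \<open>x\<close>; the sign hypothesis makes it nonnegative.\<close>
  define d where "d j = (if x $ j = 0 then 0 else - (M *v x) $ j / x $ j)" for j
  have d: "0 \<le> d j" for j
    using x[of j] by (auto simp: d_def divide_le_0_iff mult_le_0_iff)
  let ?N = "(\<chi> i. if i \<in> S then M $ i + d i *s axis i 1 else if i \<in> {} then M $ i else axis i 1)
    :: real^'n^'n"
  have "(?N *v x) $ i = 0" for i
  proof (cases "i \<in> S")
    case True
    then have "(?N *v x) $ i = (M *v x) $ i + d i * x $ i"
      by (simp add: matrix_mult_dot inner_add_left inner_axis' scalar_mult_eq_scaleR)
    with True show ?thesis
      by (simp add: d_def S_def)
  next
    case False
    then have "(?N *v x) $ i = x $ i"
      by (simp add: matrix_mult_dot inner_axis')
    with False show ?thesis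
      by (simp add: S_def)
  qed
  then have "?N *v x = 0"
    by (simp add: vec_eq_iff)
  with \<open>x \<noteq> 0\<close> have "\<not> invertible ?N"
    using matrix_left_invertible_ker[of ?N] invertible_left_inverse[of ?N] by blast
  then have "det ?N = 0"
    by (simp add: invertible_det_nz)
  moreover have "0 < det ?N"
    using P_matrix_det_pos[OF M d, of "{}" S] by simp
  ultimately show False by simp
qed

section \<open>Metric projections\<close>

lemma proj_set_iff: "p \<in> proj_set S v \<longleftrightarrow> p \<in> S \<and> (\<forall>s\<in>S. norm (v - p) \<le> norm (v - s))"
  by (auto simp: proj_set_def is_arg_min_def not_less)

lemma proj_set_infdist: "p \<in> proj_set S v \<Longrightarrow> infdist v S = norm (v - p)"
  by (rule antisym) (auto simp: proj_set_iff infdist_def dist_norm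
    intro!: cINF_greatest cINF_lower bdd_belowI2)

lemma proj_set_nonempty:
  fixes S :: "'a::{real_normed_vector,heine_borel} set"
  assumes "closed S" "S \<noteq> {}"
  obtains p where "p \<in> proj_set S v"
proof -
  obtain p where "p \<in> S" "infdist v S = dist v p"
    using infdist_attains_inf[OF assms] by blast
  then have "p \<in> proj_set S v"
    using infdist_le[of _ S v] by (auto simp: proj_set_iff simp flip: dist_norm)
  with that show ?thesis .
qed

text \<open>Projections onto a nonconvex set are multivalued; the closed graph replaces continuity
  when limits of iterates are taken.\<close>

lemma proj_set_closed_graph:
  assumes "closed S" "\<And>k. p k \<in> proj_set S (v k)" "p \<longlonglongrightarrow> p'" "v \<longlonglongrightarrow> v'"
  shows "p' \<in> proj_set S v'"
  unfolding proj_set_iff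
proof (intro conjI ballI)
  show "p' \<in> S"
    using assms by (meson closed_sequentially proj_set_iff)
  fix s assume s: "s \<in> S"
  have "(\<lambda>k. norm (v k - p k)) \<longlonglongrightarrow> norm (v' - p')" "(\<lambda>k. norm (v k - s)) \<longlonglongrightarrow> norm (v' - s)"
    using assms by (auto intro!: tendsto_intros)
  then show "norm (v' - p') \<le> norm (v' - s)"
    using assms(2) s by (intro LIMSEQ_le) (auto simp: proj_set_iff)
qed

text \<open>First-order optimality for projections onto possibly nonconvex sets: compare
  \<open>p\<close> with \<open>p + e *\<^sub>R d\<close>, expand the squares, divide by
  \<open>e\<close> and let \<open>e\<close> tend to 0 from the right.\<close>

lemma proj_set_feasible_direction:
  fixes p g d :: "'a::real_inner"
  assumes p: "p \<in> proj_set S (p - c *\<^sub>R g)" and "0 < c" "0 < \<delta>"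
    and feas: "\<And>e. 0 < e \<Longrightarrow> e < \<delta> \<Longrightarrow> p + e *\<^sub>R d \<in> S"
  shows "0 \<le> g \<bullet> d"
proof -
  have "0 \<le> e * (d \<bullet> d) + 2 * c * (g \<bullet> d)" if e: "0 < e" "e < \<delta>" for e
  proof -
    have "norm (c *\<^sub>R g) \<le> norm (c *\<^sub>R g + e *\<^sub>R d)"
      using p feas[OF e] norm_minus_cancel[of "c *\<^sub>R g + e *\<^sub>R d"]
      unfolding proj_set_iff by (auto simp: algebra_simps)
    then have "(norm (c *\<^sub>R g))\<^sup>2 \<le> (norm (c *\<^sub>R g + e *\<^sub>R d))\<^sup>2"
      by (simp add: power_mono)
    then have "0 \<le> e * (e * (d \<bullet> d) + 2 * c * (g \<bullet> d))"
      unfolding power2_norm_eq_inner by (simp add: algebra_simps inner_commute)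
    with e show ?thesis by (simp add: zero_le_mult_iff)
  qed
  then have "eventually (\<lambda>e. 0 \<le> e * (d \<bullet> d) + 2 * c * (g \<bullet> d)) (at_right 0)"
    using \<open>0 < \<delta>\<close> by (auto simp: eventually_at_right_field)
  moreover have "((\<lambda>e. e * (d \<bullet> d) + 2 * c * (g \<bullet> d)) \<longlongrightarrow> 0 * (d \<bullet> d) + 2 * c * (g \<bullet> d)) (at_right 0)"
    by (intro tendsto_intros)
  ultimately have "0 \<le> 0 * (d \<bullet> d) + 2 * c * (g \<bullet> d)"
    by (intro tendsto_lowerbound) auto
  with \<open>0 < c\<close> show ?thesis by (simp add: zero_le_mult_iff)
qed

lemma proj_set_nonexpansive:
  fixes p q v :: "'a::euclidean_space"
  assumes "p \<in> proj_set C v" "convex C" "closed C" "q \<in> C"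
  shows "norm (p - q) \<le> norm (v - q)"
proof -
  have "(v - p) \<bullet> (q - p) \<le> 0"
    using assms by (intro any_closest_point_dot[of C]) (auto simp: proj_set_iff dist_norm)
  then have "(norm (p - q))\<^sup>2 \<le> (v - q) \<bullet> (p - q)"
    unfolding power2_norm_eq_inner by (simp add: algebra_simps inner_commute)
  also have "\<dots> \<le> norm (v - q) * norm (p - q)"
    by (rule norm_cauchy_schwarz)
  finally show ?thesis
    by (cases "p = q") (simp_all add: power2_eq_square)
qed

section \<open>Convergence of descent sequences\<close>

text \<open>The decreases telescope, so \<open>z k - w k\<close> and \<open>w (Suc k) - z k\<close>
  both vanish; coercivity provides cluster points, and \<open>limit\<close> identifies each of them
  with \<open>ws\<close>. The inequalities start at \<open>k = 1\<close> because \<open>w 0\<close>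
  may lie outside \<open>S2\<close>, where \<open>PS_descent\<close> does not apply.\<close>

lemma descent_converges:
  fixes V :: "'a::euclidean_space \<Rightarrow> real"
  assumes V_nonneg: "\<And>x. 0 \<le> V x"
    and V_coercive: "\<And>C. bounded {x. V x \<le> C}"
    and "0 < c" "0 < s"
    and descent: "\<And>k. 1 \<le> k \<Longrightarrow> V (w (Suc k)) \<le> V (z k) - c * (norm (w (Suc k) - z k))\<^sup>2"
    and extrapolation: "\<And>k. 1 \<le> k \<Longrightarrow> V (z k) \<le> V (w k) - s * (norm (z k - w k))\<^sup>2"
    and step: "\<And>k. w (Suc k) \<in> T (z k)"
    and limit: "\<And>l z w. z \<longlonglongrightarrow> l \<Longrightarrow> w \<longlonglongrightarrow> l \<Longrightarrow> (\<And>k :: nat. w k \<in> T (z k)) \<Longrightarrow> l = ws"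
  shows "w \<longlonglongrightarrow> ws"
proof -
  \<comment> \<open>The shift by one makes both inequalities available at every index.\<close>
  define v where "v k = V (w (Suc k))" for k
  define \<alpha> where "\<alpha> k = s * (norm (z (Suc k) - w (Suc k)))\<^sup>2" for k
  define \<beta> where "\<beta> k = c * (norm (w (Suc (Suc k)) - z (Suc k)))\<^sup>2" for k
  have nonneg: "0 \<le> \<alpha> k" "0 \<le> \<beta> k" for k
    using \<open>0 < c\<close> \<open>0 < s\<close> by (auto simp: \<alpha>_def \<beta>_def)
  have dec: "\<alpha> k + \<beta> k \<le> v k - v (Suc k)" for k
    using descent[of "Suc k"] extrapolation[of "Suc k"] by (simp add: v_def \<alpha>_def \<beta>_def)
  have "decseq v"
  proof (rule decseq_SucI)
    show "v (Suc k) \<le> v k" for k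
      using dec[of k] nonneg[of k] by linarith
  qed
  then obtain vl where vl: "v \<longlonglongrightarrow> vl"
    using decseq_convergent[of v 0] V_nonneg unfolding v_def by blast
  then have diff0: "(\<lambda>k. v k - v (Suc k)) \<longlonglongrightarrow> 0"
    using tendsto_diff[OF vl LIMSEQ_Suc[OF vl]] by simp
  have "\<alpha> \<longlonglongrightarrow> 0" "\<beta> \<longlonglongrightarrow> 0"
    using nonneg order_trans[OF _ dec]
    by (auto intro!: tendsto_sandwich[OF _ _ tendsto_const diff0] always_eventually)
  have null: "a \<longlonglongrightarrow> 0"
    if "(\<lambda>k. r * (norm (a k))\<^sup>2) \<longlonglongrightarrow> 0" "0 < r" for r and a :: "nat \<Rightarrow> 'a"
  proof -
    have "(\<lambda>k. sqrt ((r * (norm (a k))\<^sup>2) / r)) \<longlonglongrightarrow> sqrt (0 / r)"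
      using that by (intro tendsto_real_sqrt tendsto_divide tendsto_const) auto
    with \<open>0 < r\<close> show ?thesis
      by (simp add: tendsto_norm_zero_iff)
  qed
  have zw: "(\<lambda>k. z (Suc k) - w (Suc k)) \<longlonglongrightarrow> 0"
    using \<open>\<alpha> \<longlonglongrightarrow> 0\<close> \<open>0 < s\<close> unfolding \<alpha>_def by (rule null)
  have wz: "(\<lambda>k. w (Suc (Suc k)) - z (Suc k)) \<longlonglongrightarrow> 0"
    using \<open>\<beta> \<longlonglongrightarrow> 0\<close> \<open>0 < c\<close> unfolding \<beta>_def by (rule null)
  have "v k \<le> v 0" for k
    using \<open>decseq v\<close> by (simp add: decseq_def)
  then have bdd: "bounded (range (\<lambda>k. w (Suc k)))"
    by (intro bounded_subset[OF V_coercive[of "v 0"]]) (auto simp: v_def)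
  have "(\<lambda>k. w (Suc k)) \<longlonglongrightarrow> ws"
  proof (rule ccontr)
    assume "\<not> (\<lambda>k. w (Suc k)) \<longlonglongrightarrow> ws"
    then obtain e where "0 < e" and e: "\<not> (\<forall>\<^sub>F k in sequentially. dist (w (Suc k)) ws < e)"
      by (auto simp: tendsto_iff)
    \<comment> \<open>This subsequence stays away from \<open>ws\<close>, yet by compactness a
      further subsequence converges, and its limit has to be \<open>ws\<close>.\<close>
    obtain r :: "nat \<Rightarrow> nat" where r: "strict_mono r" "\<And>k. \<not> dist (w (Suc (r k))) ws < e"
      using not_eventually_sequentiallyD[OF e] by blast
    have "bounded (range (\<lambda>k. w (Suc (r k))))"
      by (rule bounded_subset[OF bdd]) auto
    then obtain l r' where r': "strict_mono r'" and l: "((\<lambda>k. w (Suc (r k))) \<circ> r') \<longlonglongrightarrow> l"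
      using bounded_imp_convergent_subsequence by blast
    have rr: "strict_mono (r \<circ> r')"
      using r(1) r' by (rule strict_mono_o)
    have "(\<lambda>k. w (Suc (r (r' k))) + (z (Suc (r (r' k))) - w (Suc (r (r' k))))) \<longlonglongrightarrow> l + 0"
      using l LIMSEQ_subseq_LIMSEQ[OF zw rr] by (intro tendsto_add) (auto simp: o_def)
    then have zl: "(\<lambda>k. z (Suc (r (r' k)))) \<longlonglongrightarrow> l" by simp
    have "(\<lambda>k. z (Suc (r (r' k))) + (w (Suc (Suc (r (r' k)))) - z (Suc (r (r' k))))) \<longlonglongrightarrow> l + 0"
      using zl LIMSEQ_subseq_LIMSEQ[OF wz rr] by (intro tendsto_add) (auto simp: o_def)
    then have "(\<lambda>k. w (Suc (Suc (r (r' k))))) \<longlonglongrightarrow> l" by simp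
    with zl have "l = ws"
      using step by (intro limit)
    then have "\<forall>\<^sub>F k in sequentially. dist (w (Suc (r (r' k)))) ws < e"
      using l \<open>0 < e\<close> by (auto simp: tendsto_iff o_def)
    with r(2) show False
      by simp
  qed
  then show ?thesis by (rule LIMSEQ_imp_Suc)
qed

section \<open>The complementarity cone\<close>

text \<open>Minimize \<open>h\<close> over the unit vectors of the closed cone \<open>S\<close>,
  then scale by homogeneity.\<close>

lemma positive_quadratic_lower_bound:
  fixes h :: "'a::euclidean_space \<Rightarrow> real"
  assumes "continuous_on UNIV h" "closed S"
    and cone: "\<And>r u. 0 < r \<Longrightarrow> u \<in> S \<Longrightarrow> r *\<^sub>R u \<in> S"
    and homogeneous: "\<And>r u. h (r *\<^sub>R u) = r\<^sup>2 * h u"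
    and pos: "\<And>u. u \<in> S \<Longrightarrow> u \<noteq> 0 \<Longrightarrow> 0 < h u"
  obtains c where "0 < c" "\<And>u. u \<in> S \<Longrightarrow> c * (norm u)\<^sup>2 \<le> h u"
proof -
  let ?K = "S \<inter> sphere 0 1"
  have "\<exists>c>0. \<forall>u\<in>?K. c \<le> h u"
  proof (cases "?K = {}")
    case True
    then show ?thesis by (metis empty_iff zero_less_one)
  next
    case False
    have "compact ?K"
      using \<open>closed S\<close> by (simp add: closed_Int_compact)
    then obtain u0 where "u0 \<in> ?K" "\<And>u. u \<in> ?K \<Longrightarrow> h u0 \<le> h u"
      using continuous_attains_inf[of ?K h] False assms(1)
      by (meson continuous_on_subset subset_UNIV)
    then show ?thesis
      using pos[of u0] by fastforce
  qed
  then obtain c where c: "0 < c" "\<And>u. u \<in> ?K \<Longrightarrow> c \<le> h u"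
    by blast
  have "c * (norm u)\<^sup>2 \<le> h u" if "u \<in> S" for u
  proof (cases "u = 0")
    case True
    then show ?thesis
      using homogeneous[of 0 u] by simp
  next
    case False
    with that have "inverse (norm u) *\<^sub>R u \<in> ?K"
      using cone[of "inverse (norm u)" u] by simp
    then have "c \<le> (inverse (norm u))\<^sup>2 * h u"
      using c(2) homogeneous by metis
    with False show ?thesis
      by (simp add: field_simps)
  qed
  with c(1) that show ?thesis by blast
qed

lemma lcp_matrix_mult:
  "(lcp_matrix M *v w) $ i = (M *v (\<chi> j. w $ Inl j)) $ i - w $ Inr i"
proof -
  have "(lcp_matrix M *v w) $ i
      = (\<Sum>j\<in>UNIV <+> UNIV. lcp_matrix M $ i $ j * w $ j)"
    by (simp add: matrix_vector_mult_def UNIV_Plus_UNIV)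
  also have "\<dots> = (\<Sum>j\<in>UNIV. M $ i $ j * w $ Inl j)
      + (\<Sum>j\<in>UNIV. - (mat 1 :: real^_^_) $ i $ j * w $ Inr j)"
    by (subst sum.Plus) (simp_all add: lcp_matrix_def o_def)
  also have "(\<Sum>j\<in>UNIV. - (mat 1 :: real^_^_) $ i $ j * w $ Inr j) = - w $ Inr i"
    by (simp add: mat_def if_distrib if_distribR cong: if_cong)
  finally show ?thesis
    by (simp add: matrix_vector_mult_def)
qed

lemma transpose_lcp_matrix_mult:
  "(transpose (lcp_matrix M) *v v) $ Inl j = (transpose M *v v) $ j"
  "(transpose (lcp_matrix M) *v v) $ Inr j = - v $ j"
  by (simp_all add: matrix_vector_mult_def transpose_def lcp_matrix_def mat_def if_distrib
      if_distribR cong: if_cong)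

lemma inner_transpose_mult:
  fixes B :: "real^'k^'l"
  shows "x \<bullet> (transpose B *v y) = (B *v x) \<bullet> y"
  by (metis dot_lmul_matrix inner_commute transpose_matrix_vector)

text \<open>This closed cone contains all differences of points of \<open>S2\<close>, and
  \<open>lcp_matrix M\<close> has trivial kernel on it when \<open>M\<close> is a P-matrix. Together
  these facts stand in for the injectivity that the matrix lacks on the whole space.\<close>

definition compl_cone :: "(real^('n::finite + 'n)) set" where
  "compl_cone = {u. \<forall>j. u $ Inl j * u $ Inr j \<le> 0}"

lemma closed_compl_cone: "closed (compl_cone :: (real^('n::finite + 'n)) set)"
  unfolding compl_cone_def by (intro closed_Collect_all closed_Collect_le continuous_intros)

lemma S2_diff_compl_cone:
  assumes "u \<in> S2" "v \<in> S2"
  shows "u - v \<in> compl_cone"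
  unfolding compl_cone_def
proof (intro CollectI allI)
  fix j
  have prods: "u $ Inl j * u $ Inr j = 0" "v $ Inl j * v $ Inr j = 0"
    using assms unfolding S2_def by blast+
  \<comment> \<open>Only mixed terms survive, since the products within \<open>u\<close> and within
    \<open>v\<close> vanish.\<close>
  have "(u - v) $ Inl j * (u - v) $ Inr j = - (u $ Inl j * v $ Inr j) - v $ Inl j * u $ Inr j"
    using prods by (auto simp: algebra_simps)
  also have "\<dots> \<le> 0"
  proof -
    have "0 \<le> u $ Inl j * v $ Inr j" "0 \<le> v $ Inl j * u $ Inr j"
      using assms by (auto simp: S2_def)
    then show ?thesis by linarith
  qed
  finally show "(u - v) $ Inl j * (u - v) $ Inr j \<le> 0" .
qed

lemma zero_in_S2: "0 \<in> S2"
  by (simp add: S2_def)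

lemma closed_S2: "closed (S2 :: (real^('n::finite + 'n)) set)"
  unfolding S2_def
  by (intro closed_Collect_all closed_Collect_conj closed_Collect_le closed_Collect_eq
      continuous_intros)

text \<open>For \<open>u = (x, y)\<close> the kernel equation reads \<open>y = M *v x\<close>, which
  turns the cone condition into the hypothesis of \<open>P_matrix_reverses_no_sign\<close>.\<close>

lemma P_matrix_compl_cone_kernel:
  assumes "P_matrix M" "u \<in> compl_cone" "lcp_matrix M *v u = 0"
  shows "u = 0"
proof -
  let ?x = "\<chi> j. u $ Inl j"
  have Inr: "u $ Inr j = (M *v ?x) $ j" for j
    using assms(3) lcp_matrix_mult[of M u j] by simp
  have "?x = 0"
    using assms(2) by (intro P_matrix_reverses_no_sign[OF assms(1)]) (simp add: compl_cone_def Inr)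
  moreover from this have "u $ Inl j = 0" for j
    by (metis vec_lambda_beta zero_index)
  ultimately have "u $ i = 0" for i
    using Inr by (cases i) auto
  then show ?thesis by (simp add: vec_eq_iff)
qed

lemma S2_direction:
  fixes p :: "real^('n::finite + 'n)"
  assumes "p \<in> S2"
  shows "p $ Inr j = 0 \<Longrightarrow> - p $ Inl j \<le> e \<Longrightarrow> p + e *\<^sub>R axis (Inl j) 1 \<in> S2"
    and "p $ Inl j = 0 \<Longrightarrow> - p $ Inr j \<le> e \<Longrightarrow> p + e *\<^sub>R axis (Inr j) 1 \<in> S2"
  using assms by (auto simp: S2_def axis_def)

text \<open>If both coordinates of pair \<open>j\<close> of \<open>p\<close> are zero, each may be
  increased, so both entries of \<open>g\<close> are nonnegative. If one of them is positive, it may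
  move in both directions while its partner stays zero, so its entry of \<open>g\<close> is zero and
  so is the product.\<close>

lemma S2_projection_stationary:
  fixes p g :: "real^('n::finite + 'n)"
  assumes p: "p \<in> proj_set S2 (p - c *\<^sub>R g)" and "0 < c"
  shows "0 \<le> g $ Inl j * g $ Inr j"
proof -
  have pS: "p \<in> S2"
    using p by (simp add: proj_set_iff)
  then have pj: "0 \<le> p $ Inl j" "0 \<le> p $ Inr j" "p $ Inl j = 0 \<or> p $ Inr j = 0"
    by (auto simp: S2_def)
  note fd = proj_set_feasible_direction[OF p \<open>0 < c\<close>]
  have l: "0 \<le> g $ Inl j" if "p $ Inr j = 0"
    using fd[of 1 "axis (Inl j) 1"] S2_direction(1)[OF pS that] pj by (simp add: inner_axis)
  have r: "0 \<le> g $ Inr j" if "p $ Inl j = 0"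
    using fd[of 1 "axis (Inr j) 1"] S2_direction(2)[OF pS that] pj by (simp add: inner_axis)
  have l': "g $ Inl j \<le> 0" if "0 < p $ Inl j"
    using fd[of "p $ Inl j" "- axis (Inl j) 1"] S2_direction(1)[OF pS, of j "- e" for e] pj that
    by (force simp: inner_axis)
  have r': "g $ Inr j \<le> 0" if "0 < p $ Inr j"
    using fd[of "p $ Inr j" "- axis (Inr j) 1"] S2_direction(2)[OF pS, of j "- e" for e] pj that
    by (force simp: inner_axis)
  show ?thesis
    using l r l' r' pj by (smt (verit) mult_nonneg_nonneg mult_eq_0_iff)
qed

section \<open>The feasibility problem\<close>

declare transpose_matrix_vector [simp del]

text \<open>Treats both choices of \<open>Q\<close> at once. The bound \<open>lipschitz\<close> on
  the quadratic form makes \<open>L\<close> a Lipschitz constant of the gradient.\<close>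

locale lcp_feasibility =
  fixes M Q :: "real^'n^'n" and b :: "real^'n" and A :: "real^('n + 'n)^'n" and L :: real
  assumes P: "P_matrix M"
    and A: "A = lcp_matrix M"
    and Q_sym: "transpose Q = Q"
    and Q_pos: "v \<noteq> 0 \<Longrightarrow> 0 < v \<bullet> (Q *v v)"
    and lipschitz: "(A *v u) \<bullet> (Q *v (A *v u)) \<le> L * (norm u)\<^sup>2"
begin

abbreviation f :: "real^('n + 'n) \<Rightarrow> real" where "f \<equiv> f_Q A b Q"
abbreviation g :: "real^('n + 'n) \<Rightarrow> real^('n + 'n)" where "g \<equiv> grad_f_Q A b Q"

definition q :: "real^('n + 'n) \<Rightarrow> real" where
  "q u = (A *v u) \<bullet> (Q *v (A *v u))"

text \<open>The real-valued form of \<open>V_dist\<close>. It also serves the projected subgradient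
  map, since it agrees with \<open>V_ind\<close> on \<open>S2\<close>.\<close>

definition V :: "real^('n + 'n) \<Rightarrow> real" where
  "V w = f w + 1/2 * (infdist w S2)\<^sup>2"

section \<open>The quadratic \<open>f\<close>, its lower bounds on the cone, and coercivity of
  \<open>V\<close>\<close>

lemma Q_swap: "x \<bullet> (Q *v y) = y \<bullet> (Q *v x)"
  using inner_transpose_mult[of x Q y] by (simp add: Q_sym inner_commute)

lemma f_eq: "f w = 1/2 * ((A *v w - b) \<bullet> (Q *v (A *v w - b)))"
proof -
  have "w \<bullet> ((transpose A ** Q ** A) *v w) = (A *v w) \<bullet> (Q *v (A *v w))"
    by (simp add: inner_transpose_mult flip: matrix_vector_mul_assoc)
  moreover have "w \<bullet> ((transpose A ** Q) *v b) = (A *v w) \<bullet> (Q *v b)"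
    by (simp add: inner_transpose_mult flip: matrix_vector_mul_assoc)
  ultimately show ?thesis
    using Q_swap[of b "A *v w"]
    by (simp add: f_Q_def matrix_vector_mult_diff_distrib inner_diff_left inner_diff_right
        algebra_simps)
qed

lemma f_nonneg: "0 \<le> f w"
  using Q_pos[of "A *v w - b"] by (cases "A *v w - b = 0") (simp_all add: f_eq)

lemma V_nonneg: "0 \<le> V w"
  by (simp add: V_def f_nonneg)

lemma f_expand: "f x = f w + g w \<bullet> (x - w) + 1/2 * q (x - w)"
proof -
  let ?u = "x - w"
  have "A *v x - b = (A *v w - b) + A *v ?u"
    by (simp add: matrix_vector_mult_diff_distrib)
  moreover have "g w \<bullet> ?u = (A *v ?u) \<bullet> (Q *v (A *v w - b))"
    unfolding grad_f_Q_def by (metis inner_commute inner_transpose_mult)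
  ultimately show ?thesis
    using Q_swap[of "A *v w - b" "A *v ?u"]
    by (simp add: f_eq q_def matrix_vector_right_distrib inner_add_left inner_add_right
        algebra_simps)
qed

lemma f_upper: "f x \<le> f w + g w \<bullet> (x - w) + L / 2 * (norm (x - w))\<^sup>2"
  using lipschitz[of "x - w"] by (simp add: f_expand[of x w] q_def)

lemma continuous_g: "continuous_on UNIV g"
  unfolding grad_f_Q_def
  by (intro continuous_intros matrix_vector_mult_linear_continuous_on
      continuous_on_compose2[OF matrix_vector_mult_linear_continuous_on[of UNIV]]) auto

lemma tendsto_g: "z \<longlonglongrightarrow> l \<Longrightarrow> (\<lambda>k. g (z k)) \<longlonglongrightarrow> g l"
  using continuous_g by (auto simp: continuous_on_eq_continuous_at
      intro: isCont_tendsto_compose)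

lemma continuous_f: "continuous_on UNIV f"
  using f_Q_has_derivative[OF Q_sym]
  by (meson has_derivative_at_withinI has_derivative_continuous_on)

lemma Q_lower_bound: obtains c where "0 < c" "\<And>v. c * (norm v)\<^sup>2 \<le> v \<bullet> (Q *v v)"
proof (rule positive_quadratic_lower_bound[of "\<lambda>v. v \<bullet> (Q *v v)" UNIV])
  show "continuous_on UNIV (\<lambda>v. v \<bullet> (Q *v v))"
    by (intro continuous_intros matrix_vector_mult_linear_continuous_on)
qed (auto simp: Q_pos power2_eq_square matrix_vector_mult_scaleR)

lemma A_lower_bound:
  obtains c where "0 < c" "\<And>u. u \<in> compl_cone \<Longrightarrow> c * (norm u)\<^sup>2 \<le> (norm (A *v u))\<^sup>2"
proof (rule positive_quadratic_lower_bound[of "\<lambda>u. (norm (A *v u))\<^sup>2" compl_cone])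
  show "continuous_on UNIV (\<lambda>u. (norm (A *v u))\<^sup>2)"
    by (intro continuous_intros matrix_vector_mult_linear_continuous_on)
  show "0 < (norm (A *v u))\<^sup>2" if "u \<in> compl_cone" "u \<noteq> 0" for u
    using P_matrix_compl_cone_kernel[OF P] that by (auto simp: A)
  show "r *\<^sub>R u \<in> compl_cone" if "0 < r" "u \<in> compl_cone" for r and u :: "real^('n + 'n)"
  proof -
    have "(r *\<^sub>R u) $ Inl j * (r *\<^sub>R u) $ Inr j = r\<^sup>2 * (u $ Inl j * u $ Inr j)" for j
      by (simp add: power2_eq_square)
    moreover have "r\<^sup>2 * (u $ Inl j * u $ Inr j) \<le> 0" for j
      using that by (simp add: compl_cone_def mult_nonneg_nonpos del: mult_eq_0_iff)
    ultimately show ?thesis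
      by (simp only: compl_cone_def mem_Collect_eq simp_thms)
  qed
qed (auto simp: closed_compl_cone matrix_vector_mult_scaleR power_mult_distrib)

lemma q_lower_bound:
  obtains c where "0 < c" "\<And>u. u \<in> compl_cone \<Longrightarrow> c * (norm u)\<^sup>2 \<le> q u"
proof -
  obtain c where c: "0 < c" "\<And>v. c * (norm v)\<^sup>2 \<le> v \<bullet> (Q *v v)"
    using Q_lower_bound by blast
  obtain d where d: "0 < d" "\<And>u. u \<in> compl_cone \<Longrightarrow> d * (norm u)\<^sup>2 \<le> (norm (A *v u))\<^sup>2"
    using A_lower_bound by blast
  have "c * d * (norm u)\<^sup>2 \<le> q u" if "u \<in> compl_cone" for u
    using order_trans[OF mult_left_mono[OF d(2)[OF that], of c] c(2)[of "A *v u"]] c(1)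
    by (simp add: q_def mult.assoc)
  with c(1) d(1) that show ?thesis
    by (metis mult_pos_pos)
qed

lemma V_eq: "p \<in> proj_set S2 w \<Longrightarrow> V w = f w + 1/2 * (norm (w - p))\<^sup>2"
  by (simp add: V_def proj_set_infdist)

lemma V_le: "p \<in> S2 \<Longrightarrow> V w \<le> f w + 1/2 * (norm (w - p))\<^sup>2"
  using infdist_le[of p S2 w] by (simp add: V_def dist_norm power_mono infdist_nonneg)

lemma V_on_S2: "w \<in> S2 \<Longrightarrow> V w = f w"
  by (simp add: V_def)

lemma projection_S2: obtains p where "p \<in> proj_set S2 (w :: real^('n + 'n))"
  using proj_set_nonempty[OF closed_S2] zero_in_S2 by blast

text \<open>A bound on \<open>V w\<close> bounds the residual of \<open>w\<close> and the distance
  from \<open>w\<close> to its projection \<open>p\<close>. Hence \<open>A *v p\<close> is bounded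
  by \<open>B\<close>, and \<open>A_lower_bound\<close> applies to \<open>p\<close>, which lies in
  \<open>S2\<close> and so in \<open>compl_cone\<close>.\<close>

lemma V_coercive: "bounded {w. V w \<le> C}"
proof -
  obtain c where c: "0 < c" "\<And>v. c * (norm v)\<^sup>2 \<le> v \<bullet> (Q *v v)"
    using Q_lower_bound by blast
  obtain d where d: "0 < d" "\<And>u. u \<in> compl_cone \<Longrightarrow> d * (norm u)\<^sup>2 \<le> (norm (A *v u))\<^sup>2"
    using A_lower_bound by blast
  define K where "K = onorm ((*v) A)"
  have K: "norm (A *v u) \<le> K * norm u" for u
    unfolding K_def by (intro onorm matrix_vector_mul_bounded_linear)
  have "0 \<le> K"
    unfolding K_def by (intro onorm_pos_le matrix_vector_mul_bounded_linear)
  define B where "B = sqrt (2 * C / c) + norm b + K * sqrt (2 * C)"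
  have "norm w \<le> B / sqrt d + sqrt (2 * C)" if V: "V w \<le> C" for w
  proof -
    obtain p where p: "p \<in> proj_set S2 w"
      by (rule projection_S2)
    have "(norm (w - p))\<^sup>2 \<le> 2 * C"
      using V V_eq[OF p] f_nonneg[of w] by simp
    then have wp: "norm (w - p) \<le> sqrt (2 * C)"
      by (rule real_le_rsqrt)
    have "c * (norm (A *v w - b))\<^sup>2 \<le> 2 * C"
      using V c(2)[of "A *v w - b"] zero_le_power2[of "norm (w - p)"]
      unfolding V_eq[OF p] f_eq by linarith
    then have res: "norm (A *v w - b) \<le> sqrt (2 * C / c)"
      using \<open>0 < c\<close> by (intro real_le_rsqrt) (simp add: field_simps)
    have "A *v p = (A *v w - b) + b - A *v (w - p)"
      by (simp add: matrix_vector_mult_diff_distrib)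
    also have "norm \<dots> \<le> norm (A *v w - b) + norm b + norm (A *v (w - p))"
      using norm_triangle_ineq4 norm_triangle_ineq by (smt (verit))
    also have "\<dots> \<le> B"
      unfolding B_def using res K[of "w - p"] mult_left_mono[OF wp \<open>0 \<le> K\<close>] by linarith
    finally have Ap: "norm (A *v p) \<le> B" .
    have "p \<in> compl_cone"
      using p S2_diff_compl_cone[OF _ zero_in_S2] by (auto simp: proj_set_iff)
    then have "d * (norm p)\<^sup>2 \<le> B\<^sup>2"
      using d(2) power_mono[OF Ap, of 2] by fastforce
    then have "sqrt (d * (norm p)\<^sup>2) \<le> sqrt (B\<^sup>2)"
      by (rule real_sqrt_le_mono)
    then have "sqrt d * norm p \<le> B"
      using Ap norm_ge_zero[of "A *v p"] by (simp add: real_sqrt_mult)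
    then have "norm p \<le> B / sqrt d"
      using \<open>0 < d\<close> by (simp add: field_simps)
    with wp show ?thesis
      using norm_triangle_sub[of w p] by linarith
  qed
  then show ?thesis
    by (auto simp: bounded_iff)
qed

text \<open>The common form of the fixed points of all three maps:
  \<open>l + d *\<^sub>R g l\<close> is the projection that occurs at \<open>l\<close>, and
  \<open>d\<close>, \<open>c\<close> depend on the map. Once the gradient is shown to vanish, this
  point is \<open>l\<close> itself.\<close>

lemma stationary_solution:
  assumes "l + d *\<^sub>R g l \<in> proj_set S2 (l + d *\<^sub>R g l - c *\<^sub>R g l)" "0 < c"
  shows "l \<in> S1 A b \<inter> S2"
proof -
  define \<mu> where "\<mu> = Q *v (A *v l - b)"
  have g: "g l $ Inl j = (transpose M *v \<mu>) $ j" "g l $ Inr j = - \<mu> $ j" for j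
    by (simp_all add: grad_f_Q_def \<mu>_def A transpose_lcp_matrix_mult)
  have "\<mu> = 0"
  proof (rule P_matrix_reverses_no_sign[OF P_matrix_transpose[OF P]])
    show "\<mu> $ j * (transpose M *v \<mu>) $ j \<le> 0" for j
      using S2_projection_stationary[OF assms, of j] by (simp add: g mult.commute)
  qed
  then have "g l = 0"
    by (simp add: grad_f_Q_def \<mu>_def)
  moreover have "A *v l - b = 0"
    using Q_pos[of "A *v l - b"] \<open>\<mu> = 0\<close> by (auto simp: \<mu>_def)
  ultimately show ?thesis
    using assms by (simp add: S1_def proj_set_iff)
qed

section \<open>Sufficient decrease along each of the three maps\<close>

lemma PDMC_descent:
  assumes "0 < lam" "lam * L \<le> 1" "x \<in> T_PDMC A b Q lam z"
  shows "V x \<le> V z - 1/2 * (norm (x - z))\<^sup>2"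
proof -
  obtain p where p: "p \<in> proj_set S2 z"
    and x: "x = (1 / (1 + lam)) *\<^sub>R (z - lam *\<^sub>R g z + lam *\<^sub>R p)"
    using assms(3) by (auto simp: T_PDMC_def)
  let ?u = "x - z"
  have "(1 + lam) *\<^sub>R x = z - lam *\<^sub>R g z + lam *\<^sub>R p"
    using \<open>0 < lam\<close> by (simp add: x)
  then have "lam *\<^sub>R (g z + (x - p)) = - ?u"
    by (simp add: algebra_simps)
  then have "lam * (g z \<bullet> ?u + (x - p) \<bullet> ?u) = - (norm ?u)\<^sup>2"
    by (metis inner_add_left inner_minus_left inner_scaleR_left power2_norm_eq_inner)
  moreover have "lam * L * (norm ?u)\<^sup>2 \<le> 1 * (norm ?u)\<^sup>2"
    using assms(2) by (rule mult_right_mono) simp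
  moreover have "lam * (g z \<bullet> ?u + (x - p) \<bullet> ?u + L / 2 * (norm ?u)\<^sup>2)
      = lam * (g z \<bullet> ?u + (x - p) \<bullet> ?u) + lam * L * (norm ?u)\<^sup>2 / 2"
    by (simp only: distrib_left)
  ultimately have "lam * (g z \<bullet> ?u + (x - p) \<bullet> ?u + L / 2 * (norm ?u)\<^sup>2) \<le> 0"
    using zero_le_power2[of "norm ?u"] by linarith
  then have "g z \<bullet> ?u + (x - p) \<bullet> ?u + L / 2 * (norm ?u)\<^sup>2 \<le> 0"
    using \<open>0 < lam\<close> by (simp add: mult_le_0_iff)
  \<comment> \<open>The last square is the source of the decrease \<open>1/2\<close>; it persists in
    the borderline case \<open>lam * L = 1\<close>.\<close>
  moreover have "(norm (z - p))\<^sup>2 = (norm (x - p))\<^sup>2 - 2 * ((x - p) \<bullet> ?u) + (norm ?u)\<^sup>2"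
    unfolding power2_norm_eq_inner by (simp add: algebra_simps inner_commute)
  moreover have "V x \<le> f x + 1/2 * (norm (x - p))\<^sup>2"
    using p by (intro V_le) (simp add: proj_set_iff)
  ultimately show ?thesis
    using f_upper[of x z] V_eq[OF p] by linarith
qed

text \<open>The update is a proximal step of half the squared distance to \<open>S2\<close>, taken
  at the gradient point \<open>y\<close>. Its optimality against \<open>z\<close>, the fact
  \<open>min\<close>, is proved by hand because the distance to \<open>S2\<close> is not
  convex.\<close>

lemma FB_descent:
  assumes "0 < lam" "x \<in> T_FB A b Q lam z"
  shows "V x \<le> V z - (1 / lam - L) / 2 * (norm (x - z))\<^sup>2"
proof -
  define y where "y = z - lam *\<^sub>R g z"
  obtain p where p: "p \<in> proj_set S2 y"
    and x: "x = (lam / (1 + lam)) *\<^sub>R p + (1 / (1 + lam)) *\<^sub>R y"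
    using assms(2) by (auto simp: T_FB_def y_def)
  obtain s where s: "s \<in> proj_set S2 z"
    by (rule projection_S2)
  \<comment> \<open>The difference of the two sides is a square, with equality for
    \<open>a = lam *\<^sub>R c\<close>.\<close>
  have young: "(norm (a + c))\<^sup>2 \<le> (1 + lam) * ((norm a)\<^sup>2 / lam + (norm c)\<^sup>2)"
    for a c :: "real^('n + 'n)"
  proof -
    have "(1 + lam) * ((norm a)\<^sup>2 / lam + (norm c)\<^sup>2) - (norm (a + c))\<^sup>2
        = (norm (a - lam *\<^sub>R c))\<^sup>2 / lam"
      using \<open>0 < lam\<close> unfolding power2_norm_eq_inner
      by (simp add: field_simps inner_add_left inner_add_right inner_diff_left inner_diff_right
          inner_commute power2_eq_square)
    also have "0 \<le> \<dots>"
      using \<open>0 < lam\<close> by simp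
    finally show ?thesis by simp
  qed
  have "(1 + lam) *\<^sub>R x = lam *\<^sub>R p + y"
    using \<open>0 < lam\<close> by (simp add: x scaleR_add_right)
  then have "(1 + lam) *\<^sub>R (x - y) = lam *\<^sub>R (p - y)" "(1 + lam) *\<^sub>R (x - p) = y - p"
    by (simp_all add: algebra_simps)
  then have "(1 + lam) * norm (x - y) = lam * norm (y - p)" "(1 + lam) * norm (x - p) = norm (y - p)"
    using \<open>0 < lam\<close>
    by (metis abs_of_pos add_pos_pos norm_minus_commute norm_scaleR zero_less_one)+
  then have "norm (x - y) = lam / (1 + lam) * norm (y - p)"
    "norm (x - p) = 1 / (1 + lam) * norm (y - p)"
    using \<open>0 < lam\<close> by (simp_all add: field_simps)
  then have "(norm (x - y))\<^sup>2 = (lam / (1 + lam))\<^sup>2 * (norm (y - p))\<^sup>2"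
    "(norm (x - p))\<^sup>2 = (1 / (1 + lam))\<^sup>2 * (norm (y - p))\<^sup>2"
    by (simp_all only: power_mult_distrib)
  \<comment> \<open>The point \<open>x\<close> divides the segment from \<open>y\<close> to
    \<open>p\<close> so that \<open>young\<close> becomes an equality: the left side evaluates to
    the squared distance from \<open>y\<close> to \<open>p\<close>.\<close>
  then have "(1 + lam) * ((norm (x - y))\<^sup>2 / lam + (norm (x - p))\<^sup>2)
      = ((1 + lam) * ((lam / (1 + lam))\<^sup>2 / lam + (1 / (1 + lam))\<^sup>2)) * (norm (y - p))\<^sup>2"
    by (simp only: distrib_left distrib_right times_divide_eq_left times_divide_eq_right mult.assoc)
  also have "(lam / (1 + lam))\<^sup>2 / lam = lam / (1 + lam)\<^sup>2"
    by (simp add: power2_eq_square)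
  also have "lam / (1 + lam)\<^sup>2 + (1 / (1 + lam))\<^sup>2 = (1 + lam) / (1 + lam)\<^sup>2"
    by (simp add: power_divide add_divide_distrib)
  also have "(1 + lam) * ((1 + lam) / (1 + lam)\<^sup>2) = 1"
    using \<open>0 < lam\<close> by (simp add: power2_eq_square)
  also have "1 * (norm (y - p))\<^sup>2 = (norm (y - p))\<^sup>2"
    by simp
  also have "\<dots> \<le> (norm (y - s))\<^sup>2"
    using p s by (intro power_mono) (auto simp: proj_set_iff)
  also have "\<dots> \<le> (1 + lam) * ((norm (y - z))\<^sup>2 / lam + (norm (z - s))\<^sup>2)"
    using young[of "y - z" "z - s"] by simp
  finally have min: "(norm (x - y))\<^sup>2 / lam + (norm (x - p))\<^sup>2
      \<le> (norm (y - z))\<^sup>2 / lam + (norm (z - s))\<^sup>2"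
    using \<open>0 < lam\<close> by simp
  have "(norm (x - y))\<^sup>2 = (norm (x - z))\<^sup>2 + 2 * lam * (g z \<bullet> (x - z)) + (norm (y - z))\<^sup>2"
    unfolding power2_norm_eq_inner y_def by (simp add: algebra_simps inner_commute)
  moreover define r where "r = (norm (x - z))\<^sup>2 / lam"
  ultimately have "(norm (x - y))\<^sup>2 / lam = r + 2 * (g z \<bullet> (x - z)) + (norm (y - z))\<^sup>2 / lam"
    using \<open>0 < lam\<close> by (simp add: field_simps)
  moreover have "V x \<le> f x + 1/2 * (norm (x - p))\<^sup>2"
    using p by (intro V_le) (simp add: proj_set_iff)
  ultimately have "V x \<le> V z - (r / 2 - L / 2 * (norm (x - z))\<^sup>2)"
    using min f_upper[of x z] V_eq[OF s] by linarith
  then show ?thesis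
    by (simp add: r_def diff_divide_distrib left_diff_distrib)
qed

text \<open>As \<open>z\<close> lies in \<open>S2\<close>, it competes with \<open>x\<close> in the
  projection of \<open>y\<close>. The resulting constant is positive exactly when
  \<open>lam * L < 1\<close>.\<close>

lemma PS_descent:
  assumes "0 < lam" "x \<in> T_PS A b Q lam z" "z \<in> S2"
  shows "f x \<le> f z - (1 / lam - L) / 2 * (norm (x - z))\<^sup>2"
proof -
  define y where "y = z - lam *\<^sub>R g z"
  have "norm (y - x) \<le> norm (y - z)"
    using assms(2,3) unfolding T_PS_def proj_set_iff y_def by blast
  then have "(norm (y - x))\<^sup>2 \<le> (norm (y - z))\<^sup>2"
    by (simp add: power_mono)
  moreover have "(norm (y - x))\<^sup>2 = (norm (x - z))\<^sup>2 + 2 * lam * (g z \<bullet> (x - z)) + (norm (y - z))\<^sup>2"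
    unfolding power2_norm_eq_inner y_def by (simp add: algebra_simps inner_commute)
  ultimately have "(norm (x - z))\<^sup>2 / lam + 2 * (g z \<bullet> (x - z)) \<le> 0"
    using \<open>0 < lam\<close> by (simp add: field_simps)
  moreover define r where "r = (norm (x - z))\<^sup>2 / lam"
  ultimately have "r + 2 * (g z \<bullet> (x - z)) \<le> 0"
    by simp
  then have "f x \<le> f z - (r / 2 - L / 2 * (norm (x - z))\<^sup>2)"
    using f_upper[of x z] by linarith
  then show ?thesis
    by (simp add: r_def diff_divide_distrib left_diff_distrib)
qed

section \<open>Limits of the iterates solve the feasibility problem\<close>

lemma PDMC_limit:
  assumes "0 < lam" "z \<longlonglongrightarrow> l" "x \<longlonglongrightarrow> l" "\<And>k :: nat. x k \<in> T_PDMC A b Q lam (z k)"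
  shows "l \<in> S1 A b \<inter> S2"
proof (rule stationary_solution[where d = 1 and c = 1])
  \<comment> \<open>The update solved for the projection, which thus converges along with
    \<open>x\<close> and \<open>z\<close>, namely to \<open>l + g l\<close>.\<close>
  define p where "p k = (1 / lam) *\<^sub>R ((1 + lam) *\<^sub>R x k - z k) + g (z k)" for k
  have "p k \<in> proj_set S2 (z k)" for k
  proof -
    obtain p' where p': "p' \<in> proj_set S2 (z k)"
      "x k = (1 / (1 + lam)) *\<^sub>R (z k - lam *\<^sub>R g (z k) + lam *\<^sub>R p')"
      using assms(4)[of k] by (auto simp: T_PDMC_def)
    then have "(1 + lam) *\<^sub>R x k - z k = lam *\<^sub>R (p' - g (z k))"
      using \<open>0 < lam\<close> by (simp add: scaleR_diff_right)
    then have "p k = p'"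
      using \<open>0 < lam\<close> by (simp add: p_def)
    with p' show ?thesis by simp
  qed
  moreover have "p \<longlonglongrightarrow> (1 / lam) *\<^sub>R ((1 + lam) *\<^sub>R l - l) + g l"
    unfolding p_def using assms(2,3) by (intro tendsto_intros tendsto_g)
  ultimately show "l + 1 *\<^sub>R g l \<in> proj_set S2 (l + 1 *\<^sub>R g l - 1 *\<^sub>R g l)"
    using proj_set_closed_graph[OF closed_S2 _ _ assms(2), of p] \<open>0 < lam\<close>
    by (simp add: algebra_simps)
qed simp

lemma FB_limit:
  assumes "0 < lam" "z \<longlonglongrightarrow> l" "x \<longlonglongrightarrow> l" "\<And>k :: nat. x k \<in> T_FB A b Q lam (z k)"
  shows "l \<in> S1 A b \<inter> S2"
\<comment> \<open>In the limit the projection is \<open>p = l + g l\<close>, and the projected point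
  \<open>l - lam *\<^sub>R g l\<close> equals \<open>p - (1 + lam) *\<^sub>R g l\<close>.\<close>
proof (rule stationary_solution[where d = 1 and c = "1 + lam"])
  define y where "y k = z k - lam *\<^sub>R g (z k)" for k
  define p where "p k = (1 / lam) *\<^sub>R ((1 + lam) *\<^sub>R x k - y k)" for k
  have "p k \<in> proj_set S2 (y k)" for k
  proof -
    obtain p' where p': "p' \<in> proj_set S2 (y k)"
      "x k = (lam / (1 + lam)) *\<^sub>R p' + (1 / (1 + lam)) *\<^sub>R y k"
      using assms(4)[of k] by (auto simp: T_FB_def y_def)
    then have "p k = p'"
      using \<open>0 < lam\<close> by (simp add: p_def scaleR_add_right)
    with p' show ?thesis by simp
  qed
  moreover have y: "y \<longlonglongrightarrow> l - lam *\<^sub>R g l"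
    unfolding y_def using assms(2) by (intro tendsto_intros tendsto_g)
  moreover have "p \<longlonglongrightarrow> (1 / lam) *\<^sub>R ((1 + lam) *\<^sub>R l - (l - lam *\<^sub>R g l))"
    unfolding p_def using assms(3) y by (intro tendsto_intros)
  ultimately have "(1 / lam) *\<^sub>R ((1 + lam) *\<^sub>R l - (l - lam *\<^sub>R g l)) \<in> proj_set S2 (l - lam *\<^sub>R g l)"
    using proj_set_closed_graph[OF closed_S2] by blast
  moreover have "(1 / lam) *\<^sub>R ((1 + lam) *\<^sub>R l - (l - lam *\<^sub>R g l)) = l + g l"
    using \<open>0 < lam\<close> by (simp add: algebra_simps)
  ultimately show "l + 1 *\<^sub>R g l \<in> proj_set S2 (l + 1 *\<^sub>R g l - (1 + lam) *\<^sub>R g l)"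
    by (simp add: algebra_simps)
qed (use \<open>0 < lam\<close> in simp)

lemma PS_limit:
  assumes "0 < lam" "z \<longlonglongrightarrow> l" "x \<longlonglongrightarrow> l" "\<And>k :: nat. x k \<in> T_PS A b Q lam (z k)"
  shows "l \<in> S1 A b \<inter> S2"
proof (rule stationary_solution[where d = 0 and c = lam])
  have "(\<lambda>k. z k - lam *\<^sub>R g (z k)) \<longlonglongrightarrow> l - lam *\<^sub>R g l"
    using assms(2) by (intro tendsto_intros tendsto_g)
  then show "l + 0 *\<^sub>R g l \<in> proj_set S2 (l + 0 *\<^sub>R g l - lam *\<^sub>R g l)"
    using proj_set_closed_graph[OF closed_S2 _ assms(3), of "\<lambda>k. z k - lam *\<^sub>R g (z k)"] assms(4)
    by (simp add: T_PS_def)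
qed fact

section \<open>Existence and uniqueness of the solution\<close>

lemma solution_unique:
  assumes "u \<in> S1 A b \<inter> S2" "v \<in> S1 A b \<inter> S2"
  shows "u = v"
  using P_matrix_compl_cone_kernel[OF P S2_diff_compl_cone, of u v] assms
  by (simp add: S1_def A matrix_vector_mult_diff_distrib)

text \<open>A minimizer of \<^term>\<open>f\<close> over \<^term>\<open>S2\<close> is a fixed point of the projected gradient map.\<close>

lemma solution_exists: "\<exists>ws. S1 A b \<inter> S2 = {ws}"
proof -
  let ?K = "S2 \<inter> {w. f w \<le> f 0}"
  have "bounded ?K"
    by (rule bounded_subset[OF V_coercive[of "f 0"]]) (auto simp: V_on_S2)
  moreover have "closed {w. f w \<le> f 0}"
    using continuous_f by (intro closed_Collect_le) auto
  then have "closed ?K"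
    by (intro closed_Int closed_S2)
  ultimately have "compact ?K"
    by (simp add: compact_eq_bounded_closed)
  moreover have "0 \<in> ?K"
    by (simp add: zero_in_S2)
  ultimately obtain m where m: "m \<in> ?K" "\<And>w. w \<in> ?K \<Longrightarrow> f m \<le> f w"
    using continuous_attains_inf[of ?K f] continuous_on_subset[OF continuous_f] by blast
  have min: "f m \<le> f w" if "w \<in> S2" for w
    using m that by (cases "f w \<le> f 0") fastforce+
  \<comment> \<open>A stepsize with \<open>1 / lam - L\<close> positive whatever the sign of
    \<open>L\<close>.\<close>
  define lam where "lam = 1 / (\<bar>L\<bar> + 1)"
  have lam: "0 < lam" "0 < 1 / lam - L"
    by (auto simp: lam_def)
  obtain p where p: "p \<in> T_PS A b Q lam m"
    using projection_S2 unfolding T_PS_def by blast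
  then have "f m \<le> f p"
    by (intro min) (simp add: T_PS_def proj_set_iff)
  moreover have "f p \<le> f m - (1 / lam - L) / 2 * (norm (p - m))\<^sup>2"
    using m(1) by (intro PS_descent[OF lam(1) p]) simp
  ultimately have "(1 / lam - L) / 2 * (norm (p - m))\<^sup>2 \<le> 0"
    by linarith
  with lam(2) have "p = m"
    by (simp add: mult_le_0_iff)
  \<comment> \<open>A fixed point is a limit of constant iterates.\<close>
  with p have "m \<in> S1 A b \<inter> S2"
    using PS_limit[OF lam(1), of "\<lambda>_. m" m "\<lambda>_. m"] by simp
  then show ?thesis
    using solution_unique by blast
qed

section \<open>Global convergence of the accelerated algorithms\<close>

lemma accelerated_V_dist_converges:
  assumes acc: "accelerated_iterates T (V_dist A b Q) D \<sigma> w" and "0 < \<sigma>" "0 < c"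
    and descent: "\<And>x z. x \<in> T z \<Longrightarrow> V x \<le> V z - c * (norm (x - z))\<^sup>2"
    and limit: "\<And>l z x. z \<longlonglongrightarrow> l \<Longrightarrow> x \<longlonglongrightarrow> l \<Longrightarrow> (\<And>k :: nat. x k \<in> T (z k)) \<Longrightarrow> l = ws"
  shows "w \<longlonglongrightarrow> ws"
proof -
  obtain t z where z: "\<And>k. z k = w k + t k *\<^sub>R direction D w k"
    and Vz: "\<And>k. V_dist A b Q (z k)
      \<le> V_dist A b Q (w k) - ereal (\<sigma> / 2 * (t k)\<^sup>2 * (norm (direction D w k))\<^sup>2)"
    and step: "\<And>k. w (Suc k) \<in> T (z k)"
    using acc unfolding accelerated_iterates_def by blast
  show ?thesis
  proof (rule descent_converges[where V = V and c = c and s = "\<sigma> / 2" and T = T and z = z,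
        OF V_nonneg V_coercive \<open>0 < c\<close> _ _ _ step limit])
    show "0 < \<sigma> / 2"
      using \<open>0 < \<sigma>\<close> by simp
    show "V (w (Suc k)) \<le> V (z k) - c * (norm (w (Suc k) - z k))\<^sup>2" for k
      using step by (rule descent)
    show "V (z k) \<le> V (w k) - \<sigma> / 2 * (norm (z k - w k))\<^sup>2" for k
      using Vz[of k] by (simp add: V_dist_def V_def z power_mult_distrib mult.assoc)
  qed
qed

lemma accelerated_PS_converges:
  assumes acc: "accelerated_iterates (T_PS A b Q lam) (V_ind A b Q) D \<sigma> w" and "0 < \<sigma>"
    and lam: "0 < lam" "lam * L < 1" and ws: "S1 A b \<inter> S2 = {ws}"
  shows "w \<longlonglongrightarrow> ws"
proof -
  obtain t z where z: "\<And>k. z k = w k + t k *\<^sub>R direction D w k"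
    and Vz: "\<And>k. V_ind A b Q (z k)
      \<le> V_ind A b Q (w k) - ereal (\<sigma> / 2 * (t k)\<^sup>2 * (norm (direction D w k))\<^sup>2)"
    and step: "\<And>k. w (Suc k) \<in> T_PS A b Q lam (z k)"
    using acc unfolding accelerated_iterates_def by blast
  have c: "0 < (1 / lam - L) / 2"
    using lam by (simp add: field_simps)
  have wS: "w k \<in> S2" if "1 \<le> k" for k
    using step[of "k - 1"] that by (simp add: T_PS_def proj_set_iff)
  \<comment> \<open>\<open>V_ind\<close> is infinite off \<open>S2\<close> but finite at
    \<open>w k\<close>, so the decrease condition forces \<open>z k\<close> into
    \<open>S2\<close>.\<close>
  have zS: "z k \<in> S2" if "1 \<le> k" for k
    using Vz[of k] wS[OF that] by (auto simp: V_ind_def indicator_fun_def split: if_splits)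
  show ?thesis
  proof (rule descent_converges[where V = V and c = "(1 / lam - L) / 2" and s = "\<sigma> / 2"
        and T = "T_PS A b Q lam" and z = z, OF V_nonneg V_coercive c _ _ _ step])
    show "0 < \<sigma> / 2"
      using \<open>0 < \<sigma>\<close> by simp
    show "V (w (Suc k)) \<le> V (z k) - (1 / lam - L) / 2 * (norm (w (Suc k) - z k))\<^sup>2"
      if "1 \<le> k" for k
      using PS_descent[OF lam(1) step zS[OF that]] wS[of "Suc k"] zS[OF that]
      by (simp add: V_on_S2)
    show "V (z k) \<le> V (w k) - \<sigma> / 2 * (norm (z k - w k))\<^sup>2" if "1 \<le> k" for k
      using Vz[of k] wS[OF that] zS[OF that]
      by (simp add: V_on_S2 V_ind_def indicator_fun_def z power_mult_distrib mult.assoc)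
    show "l = ws" if "z \<longlonglongrightarrow> l" "x \<longlonglongrightarrow> l" "\<And>k. x k \<in> T_PS A b Q lam (z k)"
      for l and z x :: "nat \<Rightarrow> real^('n + 'n)"
      using PS_limit[OF lam(1) that] ws by simp
  qed
qed

section \<open>Linear convergence of the projected subgradient algorithm\<close>

lemma gradient_step_contraction:
  assumes "0 < lam" "lam * L \<le> 1" "ws \<in> S1 A b"
  shows "(norm (w - lam *\<^sub>R g w - ws))\<^sup>2 \<le> (norm (w - ws))\<^sup>2 - lam * q (w - ws)"
proof -
  define u where "u = w - ws"
  define h where "h = transpose A *v (Q *v (A *v u))"
  have g: "g w = h"
    using assms(3) by (simp add: grad_f_Q_def h_def u_def S1_def matrix_vector_mult_diff_distrib)
  have uh: "x \<bullet> h = (A *v x) \<bullet> (Q *v (A *v u))" for x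
    by (simp add: h_def inner_transpose_mult)
  \<comment> \<open>Nonnegativity of \<open>q\<close> at this point yields cocoercivity,
    \<open>lam * (h \<bullet> h) \<le> q u\<close>, so the second-order term of the squared step
    costs at most half of the gain \<open>2 * lam * q u\<close>.\<close>
  have "0 \<le> q (u - lam *\<^sub>R h)"
    using Q_pos[of "A *v (u - lam *\<^sub>R h)"] unfolding q_def
    by (cases "A *v (u - lam *\<^sub>R h) = 0") simp_all
  also have "\<dots> = q u - 2 * lam * (h \<bullet> h) + lam * (lam * q h)"
    using Q_swap[of "A *v u" "A *v h"]
    by (simp add: q_def uh matrix_vector_mult_diff_distrib matrix_vector_mult_scaleR
        inner_diff_left inner_diff_right algebra_simps)
  also have "lam * q h \<le> h \<bullet> h"
  proof -
    have "lam * q h \<le> lam * (L * (norm h)\<^sup>2)"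
      using lipschitz[of h] \<open>0 < lam\<close> by (simp add: q_def)
    also have "\<dots> \<le> 1 * (norm h)\<^sup>2"
      using assms(2) unfolding mult.assoc[symmetric] by (rule mult_right_mono) simp
    finally show ?thesis
      by (simp add: power2_norm_eq_inner)
  qed
  finally have "lam * (h \<bullet> h) \<le> q u"
    using \<open>0 < lam\<close> by (simp add: mult_left_mono)
  then have "lam * (lam * (h \<bullet> h)) \<le> lam * q u"
    using \<open>0 < lam\<close> by simp
  moreover have "(norm (u - lam *\<^sub>R h))\<^sup>2 = (norm u)\<^sup>2 - 2 * lam * q u + lam * (lam * (h \<bullet> h))"
    using uh[of u] unfolding power2_norm_eq_inner q_def
    by (simp add: algebra_simps inner_commute)
  moreover have "(norm (w - lam *\<^sub>R g w - ws))\<^sup>2 = (norm (u - lam *\<^sub>R h))\<^sup>2"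
    by (simp add: g u_def algebra_simps)
  ultimately show ?thesis
    unfolding u_def[symmetric] by linarith
qed

lemma PS_Q_linear:
  assumes w: "iterates (T_PS A b Q lam) w" and lim: "w \<longlonglongrightarrow> ws"
    and lam: "0 < lam" "lam * L \<le> 1" and ws: "ws \<in> S1 A b \<inter> S2"
  shows "Q_linearly_converges w ws"
proof -
  obtain c where c: "0 < c" "\<And>u. u \<in> compl_cone \<Longrightarrow> c * (norm u)\<^sup>2 \<le> q u"
    using q_lower_bound by blast
  \<comment> \<open>The maximum guards the square root against \<open>lam * c > 1\<close>.\<close>
  define \<kappa> where "\<kappa> = sqrt (max 0 (1 - lam * c))"
  have step: "w (Suc k) \<in> proj_set S2 (w k - lam *\<^sub>R g (w k))" for k
    using w by (simp add: iterates_def T_PS_def)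
  then have wS: "w (Suc k) \<in> S2" for k
    by (simp add: proj_set_iff)
  \<comment> \<open>Coordinates positive at \<open>ws\<close> are eventually positive along the
    iterates. Hence each piece containing \<open>w (Suc k)\<close> eventually contains
    \<open>ws\<close> too.\<close>
  have "\<forall>\<^sub>F k in sequentially. 0 < ws $ i \<longrightarrow> 0 < w k $ i" for i
    using order_tendstoD(1)[OF tendsto_vec_nth[OF lim, of i], of 0] by (cases "0 < ws $ i") auto
  then have pos: "\<forall>\<^sub>F k in sequentially. \<forall>i. 0 < ws $ i \<longrightarrow> 0 < w k $ i"
    by (rule eventually_all_finite)
  \<comment> \<open>The condition \<open>1 \<le> k\<close> puts \<open>w k\<close> into
    \<open>S2\<close>; the starting point is arbitrary.\<close>
  have "\<forall>\<^sub>F k in sequentially. (\<forall>i. 0 < ws $ i \<longrightarrow> 0 < w (Suc k) $ i) \<and> 1 \<le> k"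
    using iffD2[OF eventually_sequentially_Suc pos] eventually_ge_at_top by (rule eventually_conj)
  then have "\<forall>\<^sub>F k in sequentially. norm (w (Suc k) - ws) \<le> \<kappa> * norm (w k - ws)"
  proof (rule eventually_mono)
    fix k assume k: "(\<forall>i. 0 < ws $ i \<longrightarrow> 0 < w (Suc k) $ i) \<and> 1 \<le> k"
    define y where "y = w k - lam *\<^sub>R g (w k)"
    obtain J where J: "J \<in> compl_index_sets" "w (Suc k) \<in> R_piece J"
      using wS[of k] unfolding S2_eq_Union by blast
    have ws0: "0 \<le> ws $ i" for i
      using ws by (cases i) (auto simp: S2_def)
    then have "ws $ i = 0" if "i \<notin> J" for i
      using k J(2) that ws0[of i] unfolding R_piece_def by (fastforce simp: less_le)
    with ws0 have wsJ: "ws \<in> R_piece J"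
      by (simp add: R_piece_def)
    have "R_piece J \<subseteq> S2"
      using J(1) unfolding S2_eq_Union by blast
    \<comment> \<open>A projection onto \<open>S2\<close> that lands in a piece is also a projection
      onto that piece, which is convex.\<close>
    then have "w (Suc k) \<in> proj_set (R_piece J) y"
      using step[of k] J(2) unfolding y_def proj_set_iff by blast
    moreover have "convex (R_piece J)"
      by (auto simp: R_piece_def convex_def)
    moreover have "closed (R_piece J)"
      unfolding R_piece_def
      by (intro closed_Collect_conj closed_Collect_all closed_Collect_le closed_Collect_imp
          closed_Collect_eq open_Collect_const continuous_intros)
    ultimately have "norm (w (Suc k) - ws) \<le> norm (y - ws)"
      using wsJ by (rule proj_set_nonexpansive)
    also have "\<dots> = sqrt ((norm (y - ws))\<^sup>2)"
      by simp
    also have "\<dots> \<le> sqrt (max 0 (1 - lam * c) * (norm (w k - ws))\<^sup>2)"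
    proof (rule real_sqrt_le_mono)
      have "w k - ws \<in> compl_cone"
        using wS[of "k - 1"] k ws by (intro S2_diff_compl_cone) auto
      then have "lam * (c * (norm (w k - ws))\<^sup>2) \<le> lam * q (w k - ws)"
        using c(2) lam(1) by simp
      then have "(norm (y - ws))\<^sup>2 \<le> (1 - lam * c) * (norm (w k - ws))\<^sup>2"
        using gradient_step_contraction[OF lam, of ws "w k"] ws
        by (simp add: y_def algebra_simps)
      also have "\<dots> \<le> max 0 (1 - lam * c) * (norm (w k - ws))\<^sup>2"
        by (intro mult_right_mono) auto
      finally show "(norm (y - ws))\<^sup>2 \<le> max 0 (1 - lam * c) * (norm (w k - ws))\<^sup>2" .
    qed
    finally show "norm (w (Suc k) - ws) \<le> \<kappa> * norm (w k - ws)"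
      by (simp add: \<kappa>_def real_sqrt_mult)
  qed
  moreover have "0 \<le> \<kappa>" "\<kappa> < 1"
    using c(1) lam(1) by (auto simp: \<kappa>_def max_def)
  ultimately show ?thesis
    unfolding Q_linearly_converges_def by blast
qed

end

text \<open>With all extrapolation stepsizes zero the accelerated scheme is the original one, so its
  convergence results cover both.\<close>

lemma iterates_imp_accelerated:
  assumes "iterates T w"
  shows "accelerated_iterates T V D 1 w"
  unfolding accelerated_iterates_def
  by (intro exI[of _ "\<lambda>_. 0"] exI[of _ w]) (use assms in \<open>simp add: iterates_def\<close>)

section \<open>The two choices of \<open>Q\<close>, and the final assembly\<close>

lemma lcp_feasibility_normalized:
  assumes P: "P_matrix M" and A: "A = lcp_matrix M"
  shows "lcp_feasibility M (matrix_inv (A ** transpose A)) A 1"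
proof -
  let ?G = "A ** transpose A" and ?Q = "matrix_inv (A ** transpose A)"
  have Gy: "y \<bullet> (?G *v y) = (norm (transpose A *v y))\<^sup>2" for y
    by (metis inner_transpose_mult inner_commute matrix_vector_mul_assoc power2_norm_eq_inner)
  \<comment> \<open>The block \<open>-I\<close> of \<open>A\<close> makes its transpose injective,
    and with it the Gram matrix.\<close>
  have AT: "y = 0" if "transpose A *v y = 0" for y
  proof -
    have "y $ j = 0" for j
      using transpose_lcp_matrix_mult(2)[of M y j] that by (simp add: A)
    then show ?thesis by (simp add: vec_eq_iff)
  qed
  have "y = 0" if "?G *v y = 0" for y
    using Gy[of y] that by (intro AT) simp
  then have "invertible ?G"
    using matrix_left_invertible_ker[of ?G] invertible_left_inverse[of ?G] by blast
  then have "?G ** ?Q = mat 1 \<and> ?Q ** ?G = mat 1"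
    unfolding invertible_def matrix_inv_def by (rule someI_ex)
  then have inv: "?G ** ?Q = mat 1" "?Q ** ?G = mat 1"
    by simp_all
  have GQ: "?G *v (?Q *v v) = v" for v
    by (simp add: matrix_vector_mul_assoc inv)
  have form: "v \<bullet> (?Q *v v) = (norm (transpose A *v (?Q *v v)))\<^sup>2" for v
    using Gy[of "?Q *v v"] by (simp add: GQ inner_commute)
  show ?thesis
  proof
    have "transpose ?Q ** ?G = transpose (?G ** ?Q)"
      by (simp add: matrix_transpose_mul)
    then have "transpose ?Q ** ?G = mat 1"
      by (simp add: inv)
    then show "transpose ?Q = ?Q"
      by (metis inv(1) matrix_mul_assoc matrix_mul_lid matrix_mul_rid)
    show "0 < v \<bullet> (?Q *v v)" if "v \<noteq> 0" for v
    proof -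
      have "transpose A *v (?Q *v v) \<noteq> 0"
        using AT[of "?Q *v v"] GQ[of v] that by fastforce
      then show ?thesis
        by (simp add: form)
    qed
    show "(A *v u) \<bullet> (?Q *v (A *v u)) \<le> 1 * (norm u)\<^sup>2" for u
    proof -
      \<comment> \<open>The orthogonal projection of \<open>u\<close> onto the row space of
        \<open>A\<close>, hence no longer than \<open>u\<close>.\<close>
      define r where "r = transpose A *v (?Q *v (A *v u))"
      have "(norm r)\<^sup>2 = u \<bullet> r"
        unfolding r_def inner_transpose_mult by (rule form[symmetric])
      also have "\<dots> \<le> norm u * norm r"
        by (rule norm_cauchy_schwarz)
      finally have "norm r \<le> norm u"
        by (cases "r = 0") (simp_all add: power2_eq_square)
      then show ?thesis
        unfolding form r_def[symmetric] by (simp add: power_mono)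
    qed
  qed (fact P A)+
qed

lemma lcp_feasibility_identity:
  assumes "P_matrix M" and "A = lcp_matrix M"
  shows "lcp_feasibility M (mat 1) A ((onorm ((*v) A))\<^sup>2)"
proof
  show "(A *v u) \<bullet> (mat 1 *v (A *v u)) \<le> (onorm ((*v) A))\<^sup>2 * (norm u)\<^sup>2" for u
    using power_mono[OF onorm[OF matrix_vector_mul_bounded_linear[of A], of u], of 2]
    by (simp add: power_mult_distrib power2_norm_eq_inner)
qed (simp_all add: assms)

theorem corollary6p10:
  fixes M Q :: "real^'n^'n" and b :: "real^'n" and A :: "real^('n + 'n)^'n"
  assumes "P_matrix M"
    and "A = lcp_matrix M"
    and "Q \<in> {matrix_inv (A ** transpose A), mat 1}"
  shows "\<exists>ws. S1 A b \<inter> S2 = {ws} \<and>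
    (\<forall>lam. 0 < lam \<and> lam \<le> 1 / L_Q A Q \<longrightarrow>
       (\<forall>w. iterates (T_PDMC A b Q lam) w \<longrightarrow> w \<longlonglongrightarrow> ws) \<and>
       (\<forall>\<sigma>>0. \<forall>w. accelerated_iterates (T_PDMC A b Q lam) (V_dist A b Q) D_dist \<sigma> w
          \<longrightarrow> w \<longlonglongrightarrow> ws)) \<and>
    (\<forall>lam. 0 < lam \<and> lam < 1 / L_Q A Q \<longrightarrow>
       (\<forall>w. iterates (T_FB A b Q lam) w \<longrightarrow> w \<longlonglongrightarrow> ws) \<and>
       (\<forall>\<sigma>>0. \<forall>w. accelerated_iterates (T_FB A b Q lam) (V_dist A b Q) D_dist \<sigma> w
          \<longrightarrow> w \<longlonglongrightarrow> ws)) \<and>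
    (\<forall>lam. 0 < lam \<and> lam < 1 / L_Q A Q \<longrightarrow>
       (\<forall>w. iterates (T_PS A b Q lam) w \<longrightarrow> w \<longlonglongrightarrow> ws \<and> Q_linearly_converges w ws) \<and>
       (\<forall>\<sigma>>0. \<forall>w. accelerated_iterates (T_PS A b Q lam) (V_ind A b Q) R_piece \<sigma> w
          \<longrightarrow> w \<longlonglongrightarrow> ws))"
proof -
  interpret lcp_feasibility M Q b A "L_Q A Q"
    using lcp_feasibility_normalized[OF assms(1,2)] lcp_feasibility_identity[OF assms(1,2)]
      assms(3) by (auto simp: L_Q_def)
  obtain ws where ws: "S1 A b \<inter> S2 = {ws}"
    using solution_exists by blast
  have PDMC: "w \<longlonglongrightarrow> ws"
    if lam: "0 < lam" "lam \<le> 1 / L_Q A Q" and "0 < \<sigma>"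
      and w: "accelerated_iterates (T_PDMC A b Q lam) (V_dist A b Q) D_dist \<sigma> w"
    for lam \<sigma> w
  proof (rule accelerated_V_dist_converges[OF w \<open>0 < \<sigma>\<close>, where c = "1/2"])
    \<comment> \<open>A positive \<open>lam\<close> below \<open>1 / L_Q A Q\<close> rules out
      negative values and also zero, where the quotient would be 0.\<close>
    have "0 < L_Q A Q"
      using lam zero_less_divide_1_iff[of "L_Q A Q"] by linarith
    with lam have "lam * L_Q A Q \<le> 1"
      by (simp add: field_simps)
    then show "V x \<le> V z - 1/2 * (norm (x - z))\<^sup>2" if "x \<in> T_PDMC A b Q lam z" for x z
      using PDMC_descent lam(1) that by blast
    show "l = ws" if "z \<longlonglongrightarrow> l" "x \<longlonglongrightarrow> l" "\<And>k. x k \<in> T_PDMC A b Q lam (z k)"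
      for l and z x :: "nat \<Rightarrow> real^('n + 'n)"
      using PDMC_limit[OF lam(1) that] ws by simp
  qed simp
  have FB: "w \<longlonglongrightarrow> ws"
    if lam: "0 < lam" "lam < 1 / L_Q A Q" and "0 < \<sigma>"
      and w: "accelerated_iterates (T_FB A b Q lam) (V_dist A b Q) D_dist \<sigma> w"
    for lam \<sigma> w
  proof (rule accelerated_V_dist_converges[OF w \<open>0 < \<sigma>\<close>, where c = "(1 / lam - L_Q A Q) / 2"])
    have "0 < L_Q A Q"
      using lam zero_less_divide_1_iff[of "L_Q A Q"] by linarith
    with lam show "0 < (1 / lam - L_Q A Q) / 2"
      by (simp add: field_simps)
    show "V x \<le> V z - (1 / lam - L_Q A Q) / 2 * (norm (x - z))\<^sup>2" if "x \<in> T_FB A b Q lam z" for x z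
      using FB_descent lam(1) that by blast
    show "l = ws" if "z \<longlonglongrightarrow> l" "x \<longlonglongrightarrow> l" "\<And>k. x k \<in> T_FB A b Q lam (z k)"
      for l and z x :: "nat \<Rightarrow> real^('n + 'n)"
      using FB_limit[OF lam(1) that] ws by simp
  qed
  have lam_PS: "lam * L_Q A Q < 1" if "0 < lam" "lam < 1 / L_Q A Q" for lam
  proof -
    have "0 < L_Q A Q"
      using that zero_less_divide_1_iff[of "L_Q A Q"] by linarith
    with that show ?thesis
      by (simp add: field_simps)
  qed
  have PS: "w \<longlonglongrightarrow> ws"
    if "0 < lam" "lam < 1 / L_Q A Q" "0 < \<sigma>"
      "accelerated_iterates (T_PS A b Q lam) (V_ind A b Q) R_piece \<sigma> w" for lam \<sigma> w
    using accelerated_PS_converges[OF that(4,3,1) lam_PS[OF that(1,2)] ws] .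
  have PS_linear: "Q_linearly_converges w ws"
    if "0 < lam" "lam < 1 / L_Q A Q" "iterates (T_PS A b Q lam) w" for lam w
    using PS_Q_linear[OF that(3) PS[OF that(1,2) zero_less_one iterates_imp_accelerated[OF that(3)]]
        that(1)] lam_PS[OF that(1,2)] ws by auto
  note unaccelerated = zero_less_one iterates_imp_accelerated
  show ?thesis
    by (intro exI[of _ ws] conjI allI impI; (elim conjE)?)
      (rule ws | (rule PDMC; assumption) | (rule PDMC[OF _ _ unaccelerated]; assumption)
        | (rule FB; assumption) | (rule FB[OF _ _ unaccelerated]; assumption)
        | (rule PS; assumption) | (rule PS[OF _ _ unaccelerated]; assumption)
        | (rule PS_linear; assumption))+
qed

end
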